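(* Let $\mathbb{Y}=(Y,\mathcal{C},\nu,T_1,\ldots,T_l)$ be an ergodic dynamical system with the $T_i$ commuting, invertible, measure-preserving transformations, and let $f_1,\ldots,f_l\in L^\infty(\mathbb{Y})$. Then there are a dynamical system $\mathbb{X}=(\prod_{i\leq l}X_i,\mathcal{B},\mu,\tilde T_1,\ldots,\tilde T_l)$ and functions $\tilde f_1,\ldots,\tilde f_l\in L^\infty(\mathbb{X})$ such that: (1) for each $k\le l$, a measure disintegration exists for the factor $(\prod_{i\neq k}X_i,\mathcal{B}_{\overline k},\mu\upharpoonright\mathcal{B}_{\overline k},\tilde T_1,\ldots,\tilde T_l)$ of $\mathbb{X}$; (2) there exists a factor $\mathbb{X}'$ of $\mathbb{X}$ which cleanly factors $\mathbb{X}$; (3) for each $i\le l$ there is a map $S_i:X_i\to X_i$ such that $\tilde T_i(x_1,\ldots,x_i,\ldots,x_l)=(x_1,\ldots,S_i x_i,\ldots,x_l)$; (4) if $A_N(\tilde f_1,\ldots,\tilde f_l)$ converges in the $L^2$ norm as $N\to\infty$, then $A_N(f_1,\ldots,f_l)$ converges in the $L^2$ norm as well.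
   Context: A dynamical system $(Z,\mathcal{Z},\rho,R_1,\ldots,R_l)$ is a probability space together with commuting, invertible, measure-preserving transformations $R_1,\ldots,R_l$; it is ergodic if every set invariant under all the $R_i$ has measure $0$ or $1$. For bounded measurable $g_1,\dots,g_l$ on such a system, $A_N(g_1,\ldots,g_l)(z):=\frac1N\sum_{n=1}^N g_1(R_1^n z)\cdots g_l(R_l^n z)$, so in $A_N(\tilde f_1,\ldots,\tilde f_l)$ the transformations are the $\tilde T_i$, and in $A_N(f_1,\ldots,f_l)$ they are the $T_i$. A factor of a system is a system on a space $Z'$ together with a measurable, measure-preserving map (the factor map) onto it that intertwines the transformations almost everywhere. For a probability space $(\prod_{i\le l}X_i,\mathcal{B},\mu)$ (where $\mathcal{B}$ need not be a product $\sigma$-algebra) and $k\le l$, $\mathcal{B}_{\overline k}$ is the $\sigma$-algebra of sets in $\mathcal{B}$ that do not depend on the $k$-th coordinate (or differ from such a set by a null set). With respect to $\mathcal{B}_{\overline k}$, points of $\prod_{i\le l}X_i$ are identified with points $x_{\overline k}\in\prod_{i\neq k}X_i$ by discarding the $k$-th coordinate. Measure disintegration: for a factor $\pi:\mathbb{Z}\to\mathbb{Z}'$, where $\mathbb{Z}$ has measure $\mu$ and $\mathbb{Z}'$ has measure $\mu'$, a measure disintegration exists if there is a map $z'\mapsto\mu_{z'}$ from $\mathbb{Z}'$ to the space of measures on $\mathbb{Z}$ such that $\mu_{z'}$ is supported on $\pi^{-1}(z')$; the map commutes with the group action ($\mu_{T_g z'}=T_g\mu_{z'}$ for each group element $g$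 and almost every $z'$); and for every $f\in L^2(\mathbb{Z})$, $\int f\,d\mu=\iint f\,d\mu_{z'}\,d\mu'(z')$, where in particular the right side is defined. For the factor given by $\mathcal{B}_{\overline k}$, the corresponding measures are denoted $\mu_{k,x_{\overline k}}$; they are regarded as measures on $X_k$, by identifying the fiber over $x_{\overline k}$ with $X_k$. Clean factoring: let $\mathbb{X}=(\prod_{i\leq l}X_i,\mathcal{B},\mu,\tilde T_1,\ldots,\tilde T_l)$ have the measure disintegrations $\mu_{k,x_{\overline k}}$ above, and let $\mathbb{X}'=(X',\mathcal{B}',\mu',T_1',\ldots,T_l')$ be a factor of $\mathbb{X}$ with factor map $\gamma:\prod_{i\le l}X_i\to X'$. For $x_{\overline k}\in\prod_{i\ne k}X_i$ let $\gamma_{x_{\overline k}}:X_k\to X'$, $\gamma_{x_{\overline k}}(x_k):=\gamma(x_1,\ldots,x_l)$. Then $\mathbb{X}'$ cleanly factors $\mathbb{X}$ if (i) $\gamma$ is $\tilde T_i\tilde T_j^{-1}$-invariant for all $i,j\le l$ (that is, $\gamma(x)=\gamma(\tilde T_i\tilde T_j^{-1}x)$ for almost every $x$), and (ii) for each $k\le l$ and almost every $x_{\overline k}\in\prod_{i\neq k}X_i$, the function $\gamma_{x_{\overline k}}$ is an isomorphism of measure spaces from $(X_k,\mathcal{B},\mu_{k,x_{\overline k}})$ onto $(X',\mathcal{B}',\mu')$. *)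

theory Defs
  imports "HOL-Probability.Probability"
begin

text \<open>
  Measure spaces carry their \<open>\<sigma>\<close>-algebra as is: nothing is completed. The transformations and
  functions of a system are indexed by \<open>{1..l}\<close>; their values at other indices and outside
  \<^term>\<open>space M\<close> are irrelevant.
\<close>

definition measure_iso :: "'a measure \<Rightarrow> 'b measure \<Rightarrow> ('a \<Rightarrow> 'b) \<Rightarrow> bool" where
  "measure_iso M N h \<longleftrightarrow>
     bij_betw h (space M) (space N) \<and>
     h \<in> M \<rightarrow>\<^sub>M N \<and> inv_into (space M) h \<in> N \<rightarrow>\<^sub>M M \<and> distr M N h = N"

definition dynamical_system :: "nat \<Rightarrow> 'a measure \<Rightarrow> (nat \<Rightarrow> 'a \<Rightarrow> 'a) \<Rightarrow> bool" where
  "dynamical_system l M T \<longleftrightarrow>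
     prob_space M \<and>
     (\<forall>i\<in>{1..l}. measure_iso M M (T i)) \<and>
     (\<forall>i\<in>{1..l}. \<forall>j\<in>{1..l}. \<forall>x\<in>space M. T i (T j x) = T j (T i x))"

definition ergodic_system :: "nat \<Rightarrow> 'a measure \<Rightarrow> (nat \<Rightarrow> 'a \<Rightarrow> 'a) \<Rightarrow> bool" where
  "ergodic_system l M T \<longleftrightarrow>
     dynamical_system l M T \<and>
     (\<forall>A\<in>sets M. (\<forall>i\<in>{1..l}. T i -` A \<inter> space M = A) \<longrightarrow> measure M A = 0 \<or> measure M A = 1)"

definition Linf :: "'a measure \<Rightarrow> ('a \<Rightarrow> 'b::{real_normed_field, euclidean_space}) set" where
  "Linf M = {f \<in> borel_measurable M. \<exists>C. AE x in M. norm (f x) \<le> C}"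

definition L2 :: "'a measure \<Rightarrow> ('a \<Rightarrow> 'b::{real_normed_field, euclidean_space}) set" where
  "L2 M = {f \<in> borel_measurable M. integrable M (\<lambda>x. (norm (f x))\<^sup>2)}"

definition L2_convergent ::
  "'a measure \<Rightarrow> (nat \<Rightarrow> 'a \<Rightarrow> 'b::{real_normed_field, euclidean_space}) \<Rightarrow> bool" where
  "L2_convergent M F \<longleftrightarrow>
     (\<exists>g\<in>L2 M. (\<lambda>N. \<integral>\<^sup>+x. ennreal ((norm (F N x - g x))\<^sup>2) \<partial>M) \<longlonglongrightarrow> 0)"

definition ergodic_average ::
  "nat \<Rightarrow> (nat \<Rightarrow> 'a \<Rightarrow> 'a) \<Rightarrow> (nat \<Rightarrow> 'a \<Rightarrow> 'b::real_normed_field) \<Rightarrow> nat \<Rightarrow> 'a \<Rightarrow> 'b" where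
  "ergodic_average l T f N x = (\<Sum>n=1..N. \<Prod>i=1..l. f i ((T i ^^ n) x)) / of_nat N"

definition factor_system ::
  "nat \<Rightarrow> 'a measure \<Rightarrow> (nat \<Rightarrow> 'a \<Rightarrow> 'a) \<Rightarrow> 'b measure \<Rightarrow> (nat \<Rightarrow> 'b \<Rightarrow> 'b) \<Rightarrow> ('a \<Rightarrow> 'b) \<Rightarrow> bool" where
  "factor_system l M T M' T' \<pi> \<longleftrightarrow>
     dynamical_system l M T \<and> dynamical_system l M' T' \<and>
     \<pi> \<in> M \<rightarrow>\<^sub>M M' \<and> \<pi> ` space M = space M' \<and> distr M M' \<pi> = M' \<and>
     (\<forall>i\<in>{1..l}. AE x in M. \<pi> (T i x) = T' i (\<pi> x))"

definition int_iterate :: "'a measure \<Rightarrow> ('a \<Rightarrow> 'a) \<Rightarrow> int \<Rightarrow> 'a \<Rightarrow> 'a" where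
  "int_iterate M R n =
     (if 0 \<le> n then R ^^ nat n else inv_into (space M) R ^^ nat (- n))"

text \<open>
  The action of the group \<open>\<int>\<^sup>l\<close>: the exponent vector \<open>(g 1, \<dots>, g l)\<close> acts as
  \<open>T l ^ g l \<circ> \<dots> \<circ> T 1 ^ g 1\<close>.
\<close>

primrec group_act :: "'a measure \<Rightarrow> (nat \<Rightarrow> 'a \<Rightarrow> 'a) \<Rightarrow> nat \<Rightarrow> (nat \<Rightarrow> int) \<Rightarrow> 'a \<Rightarrow> 'a" where
  "group_act M T 0 g = (\<lambda>x. x)"
| "group_act M T (Suc l) g = int_iterate M (T (Suc l)) (g (Suc l)) \<circ> group_act M T l g"

text \<open>
  Measurability of the fibre is demanded explicitly, because \<^const>\<open>emeasure\<close> is \<open>0\<close> on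
  non-measurable sets, so that the condition on the complement would otherwise be void.
\<close>

definition measure_disintegration ::
  "nat \<Rightarrow> 'a measure \<Rightarrow> (nat \<Rightarrow> 'a \<Rightarrow> 'a) \<Rightarrow> 'b measure \<Rightarrow> (nat \<Rightarrow> 'b \<Rightarrow> 'b) \<Rightarrow> ('a \<Rightarrow> 'b) \<Rightarrow>
   ('b \<Rightarrow> 'a measure) \<Rightarrow> bool" where
  "measure_disintegration l M T M' T' \<pi> \<mu> \<longleftrightarrow>
     (\<forall>z\<in>space M'. sets (\<mu> z) = sets M \<and>
        \<pi> -` {z} \<inter> space M \<in> sets M \<and> emeasure (\<mu> z) (space M - \<pi> -` {z}) = 0) \<and>
     (\<forall>g. AE z in M'. \<mu> (group_act M' T' l g z) = distr (\<mu> z) M (group_act M T l g)) \<and>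
     (\<forall>f\<in>L2 M. (AE z in M'. integrable (\<mu> z) f) \<and>
        integrable M' (\<lambda>z. \<integral>x. f x \<partial>\<mu> z) \<and>
        (\<integral>x. (f x :: real) \<partial>M) = (\<integral>z. (\<integral>x. f x \<partial>\<mu> z) \<partial>M'))"

text \<open>
  From here on \<^term>\<open>M\<close> is a measure with \<^prop>\<open>space M = PiE {1..l} X\<close>; its \<open>\<sigma>\<close>-algebra need not
  be a product \<open>\<sigma>\<close>-algebra.
\<close>

definition drop_coord :: "nat \<Rightarrow> nat \<Rightarrow> (nat \<Rightarrow> 'x) \<Rightarrow> nat \<Rightarrow> 'x" where
  "drop_coord l k x = restrict x ({1..l} - {k})"

definition indep_of_coord :: "(nat \<Rightarrow> 'x) measure \<Rightarrow> nat \<Rightarrow> nat \<Rightarrow> (nat \<Rightarrow> 'x) set \<Rightarrow> bool" where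
  "indep_of_coord M l k A \<longleftrightarrow>
     (\<forall>x\<in>space M. \<forall>y\<in>space M. drop_coord l k x = drop_coord l k y \<longrightarrow> (x \<in> A \<longleftrightarrow> y \<in> A))"

definition coord_algebra :: "(nat \<Rightarrow> 'x) measure \<Rightarrow> nat \<Rightarrow> nat \<Rightarrow> (nat \<Rightarrow> 'x) set set" where
  "coord_algebra M l k =
     {A \<in> sets M. \<exists>A'\<in>sets M. indep_of_coord M l k A' \<and> (A - A') \<union> (A' - A) \<in> null_sets M}"

text \<open>
  The space \<open>\<Prod>\<^bsub>i\<noteq>k\<^esub> X\<^sub>i\<close>: a set is measurable iff its preimage under \<^const>\<open>drop_coord\<close> lies in
  \<^const>\<open>coord_algebra\<close>, and it has the measure of that preimage. The generating family is
  already a \<open>\<sigma>\<close>-algebra.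
\<close>

definition coord_factor ::
  "(nat \<Rightarrow> 'x set) \<Rightarrow> (nat \<Rightarrow> 'x) measure \<Rightarrow> nat \<Rightarrow> nat \<Rightarrow> (nat \<Rightarrow> 'x) measure" where
  "coord_factor X M l k =
     distr M
       (sigma (PiE ({1..l} - {k}) X)
         {A. A \<subseteq> PiE ({1..l} - {k}) X \<and> drop_coord l k -` A \<inter> space M \<in> coord_algebra M l k})
       (drop_coord l k)"

text \<open>
  The map induced on \<open>\<Prod>\<^bsub>i\<noteq>k\<^esub> X\<^sub>i\<close> by a transformation of the product. The choice of the preimage
  is immaterial when the transformation descends, which \<^const>\<open>factor_system\<close> enforces.
\<close>

definition coord_map ::
  "(nat \<Rightarrow> 'x) measure \<Rightarrow> nat \<Rightarrow> nat \<Rightarrow> ((nat \<Rightarrow> 'x) \<Rightarrow> nat \<Rightarrow> 'x) \<Rightarrow> (nat \<Rightarrow> 'x) \<Rightarrow> nat \<Rightarrow> 'x" where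
  "coord_map M l k R z = drop_coord l k (R (SOME x. x \<in> space M \<and> drop_coord l k x = z))"

text \<open>
  A measure \<open>m\<close> on the product which is supported on the fibre over \<open>z\<close>, transported to \<open>X\<^sub>k\<close> by
  identifying \<open>t \<in> X\<^sub>k\<close> with \<open>z(k := t)\<close>. The measurable sets are the sections at \<open>z\<close> of the sets
  in \<^term>\<open>sets M\<close>.
\<close>

definition fibre_measure ::
  "(nat \<Rightarrow> 'x set) \<Rightarrow> (nat \<Rightarrow> 'x) measure \<Rightarrow> nat \<Rightarrow> nat \<Rightarrow> (nat \<Rightarrow> 'x) \<Rightarrow> (nat \<Rightarrow> 'x) measure \<Rightarrow> 'x measure" where
  "fibre_measure X M l k z m =
     distr (restrict_space m (drop_coord l k -` {z} \<inter> space M))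
       (vimage_algebra (X k) (\<lambda>t. z(k := t)) M) (\<lambda>x. x k)"

definition cleanly_factors ::
  "nat \<Rightarrow> (nat \<Rightarrow> 'x set) \<Rightarrow> (nat \<Rightarrow> 'x) measure \<Rightarrow> (nat \<Rightarrow> (nat \<Rightarrow> 'x) \<Rightarrow> nat \<Rightarrow> 'x) \<Rightarrow>
   (nat \<Rightarrow> (nat \<Rightarrow> 'x) \<Rightarrow> (nat \<Rightarrow> 'x) measure) \<Rightarrow>
   'z measure \<Rightarrow> (nat \<Rightarrow> 'z \<Rightarrow> 'z) \<Rightarrow> ((nat \<Rightarrow> 'x) \<Rightarrow> 'z) \<Rightarrow> bool" where
  "cleanly_factors l X M T \<mu> M' T' \<gamma> \<longleftrightarrow>
     factor_system l M T M' T' \<gamma> \<and>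
     (\<forall>i\<in>{1..l}. \<forall>j\<in>{1..l}. AE x in M. \<gamma> x = \<gamma> (T i (inv_into (space M) (T j) x))) \<and>
     (\<forall>k\<in>{1..l}. AE z in coord_factor X M l k.
        measure_iso (fibre_measure X M l k z (\<mu> k z)) M' (\<lambda>t. \<gamma> (z(k := t))))"

text \<open>
  HOL cannot quantify existentially over types, so the points of the sets \<open>X\<^sub>i\<close> and of the clean
  factor are taken from one fixed type, which is large enough to contain countable ultraproducts
  of finite sets (as sets of equivalence classes of sequences).
\<close>

type_synonym point = "(nat \<Rightarrow> nat) set"

end

theory Submission
  imports Defs
begin

text \<open>
  Only the values of the \<open>f\<^sub>i\<close> along orbits matter, so \<open>Y\<close> may be replaced by a \<open>\<int>\<^sup>l\<close>-invariant
  measure \<open>\<nu>\<close> on a sequence space with at most continuum many points. Since the \<open>\<sigma>\<close>-algebras need not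
  be standard, no structure theory is needed: let every \<open>X\<^sub>i\<close> be a copy of the group
  \<open>G = \<real> \<times> \<int>\<close>, let \<open>T\<^sub>i\<close> add \<open>(0, 1)\<close> to the \<open>i\<close>-th coordinate, and let \<open>\<gamma>\<close> be the sum of the
  coordinates. A function \<open>\<Psi>\<close> on \<open>\<real>\<^sup>l\<close> extends to an equivariant map \<open>\<Phi>\<close> from \<open>G\<^sup>l\<close> to the sequence
  space, and \<open>\<Psi>\<close> can be chosen so wildly that its values along any countable family of axis-parallel
  lines, each parametrised by \<open>\<gamma>\<close>, may be prescribed at will at uncountably many parameters. The
  values along different lines can therefore be declared to be independent, each with law \<open>\<nu>\<close>. This
  gives a measure on \<open>G\<close>, copied to every line; a set generated by \<open>\<Phi>\<close> and \<open>\<gamma>\<close> depends on countably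
  many lines only, so it has the same measure on all but countably many lines of each direction, and
  this common value is its measure in \<open>G\<^sup>l\<close>. Then \<open>\<gamma>\<close> is an isomorphism on every line, and
  \<open>\<Phi>\<close> maps the measure on \<open>G\<^sup>l\<close> to \<open>\<nu>\<close>, so that \<open>L\<^sup>2\<close> convergence passes to \<open>Y\<close>.
\<close>

section \<open>Product measures and pullbacks\<close>

text \<open>A one-coordinate cylinder depends on one coordinate, and dependence on countably many
  coordinates survives complements and countable unions. Later this reduces an event about
  uncountably many lines to countably many prescriptions.\<close>

lemma PiM_countable_support:
  assumes "B \<in> sets (PiM I N)"
  shows "\<exists>J. countable J \<and> J \<subseteq> I \<and>
    (\<forall>x\<in>space (PiM I N). \<forall>y\<in>space (PiM I N). (\<forall>j\<in>J. x j = y j) \<longrightarrow> (x \<in> B \<longleftrightarrow> y \<in> B))"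
proof -
  let ?\<Omega> = "\<Pi>\<^sub>E i\<in>I. space (N i)"
  define supp where "supp J B \<longleftrightarrow> countable J \<and> J \<subseteq> I \<and>
    (\<forall>x\<in>?\<Omega>. \<forall>y\<in>?\<Omega>. (\<forall>j\<in>J. x j = y j) \<longrightarrow> (x \<in> B \<longleftrightarrow> y \<in> B))" for J B
  have "\<exists>J. supp J B"
    using assms unfolding sets_PiM_single
  proof (induction rule: sigma_sets.induct)
    case (Basic a)
    then obtain i A where "i \<in> I" "a = {f \<in> ?\<Omega>. f i \<in> A}" by auto
    then show ?case by (intro exI[of _ "{i}"]) (auto simp: supp_def)
  next
    case Empty
    show ?case by (auto simp: supp_def)
  next
    case (Compl a)
    then obtain J where "supp J a" by blast
    then have "supp J (?\<Omega> - a)" unfolding supp_def Diff_iff by blast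
    then show ?case ..
  next
    case (Union a)
    then obtain J where J: "\<And>i::nat. supp (J i) (a i)" by metis
    have "supp (\<Union>i. J i) (\<Union>i. a i)"
      unfolding supp_def
    proof (intro conjI ballI impI)
      fix x y
      assume "x \<in> ?\<Omega>" "y \<in> ?\<Omega>" "\<forall>j\<in>\<Union>i. J i. x j = y j"
      then have "x \<in> a i \<longleftrightarrow> y \<in> a i" for i using J[of i] unfolding supp_def by blast
      then show "x \<in> (\<Union>i. a i) \<longleftrightarrow> y \<in> (\<Union>i. a i)" by blast
    qed (use J in \<open>auto simp: supp_def\<close>)
    then show ?case ..
  qed
  then show ?thesis unfolding supp_def space_PiM .
qed

text \<open>Dynkin induction from cylinders, whose finite base is the exceptional set; exceptional
  sets are united along countable unions. One \<open>K\<close> must serve every \<open>D\<close>,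
  since in the application \<open>D\<close> varies with the line.\<close>

lemma PiM_independent_component:
  fixes N :: "'a measure"
  assumes N: "prob_space N" and "B \<in> sets (PiM I (\<lambda>_. N))"
  shows "\<exists>K. countable K \<and> (\<forall>j\<in>I - K. \<forall>D\<in>sets N.
    emeasure (PiM I (\<lambda>_. N)) (B \<inter> {\<omega> \<in> space (PiM I (\<lambda>_. N)). \<omega> j \<in> D}) =
    emeasure (PiM I (\<lambda>_. N)) B * emeasure N D)"
proof -
  let ?P = "PiM I (\<lambda>_. N)"
  interpret N: prob_space N by fact
  interpret P: product_prob_space "\<lambda>_. N" I by standard

  define C where "C j D = {\<omega> \<in> space ?P. \<omega> j \<in> D}" for j D
  have C_sets: "C j D \<in> sets ?P" if "j \<in> I" "D \<in> sets N" for j D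
    unfolding C_def using that by measurable
  have C_em: "emeasure ?P (C j D) = emeasure N D" if "j \<in> I" "D \<in> sets N" for j D
    unfolding C_def using P.emeasure_PiM_Collect_single[OF that] .
  have sub: "prod_algebra I (\<lambda>_. N) \<subseteq> Pow (\<Pi>\<^sub>E i\<in>I. space N)"
    using prod_algebra_sets_into_space .
  have sig: "sigma_sets (\<Pi>\<^sub>E i\<in>I. space N) (prod_algebra I (\<lambda>_. N)) = sets ?P"
    by (simp add: sets_PiM)
  have "B \<in> sigma_sets (\<Pi>\<^sub>E i\<in>I. space N) (prod_algebra I (\<lambda>_. N))"
    using assms(2) by (simp add: sets_PiM)
  then have "\<exists>K. countable K \<and> (\<forall>j\<in>I - K. \<forall>D\<in>sets N.
    emeasure ?P (B \<inter> C j D) = emeasure ?P B * emeasure N D)"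
  proof (induction rule: sigma_sets_induct_disjoint[OF Int_stable_prod_algebra sub, consumes 1, case_names basic empty compl union])
    case (basic A)
    obtain J X where A: "A = prod_emb I (\<lambda>_. N) J (Pi\<^sub>E J X)" and J: "finite J" "J \<subseteq> I"
      and X: "\<And>i. i \<in> J \<Longrightarrow> X i \<in> sets N"
      using prod_algebraE[OF basic] by metis
    have "emeasure ?P (A \<inter> C j D) = emeasure ?P A * emeasure N D"
      if j: "j \<in> I - J" and D: "D \<in> sets N" for j D
    proof -
      have "A \<inter> C j D = prod_emb I (\<lambda>_. N) (insert j J) (Pi\<^sub>E (insert j J) (X(j := D)))"
        using j by (auto simp: A C_def prod_emb_def space_PiM PiE_iff restrict_def extensional_def split: if_splits)
      also have "emeasure ?P \<dots> = (\<Prod>i\<in>insert j J. emeasure N ((X(j := D)) i))"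
        using j J X D by (intro P.emeasure_PiM_emb) auto
      also have "\<dots> = emeasure N D * (\<Prod>i\<in>J. emeasure N ((X(j := D)) i))"
        using j J by simp
      also have "(\<Prod>i\<in>J. emeasure N ((X(j := D)) i)) = (\<Prod>i\<in>J. emeasure N (X i))"
        using j by (intro prod.cong) auto
      also have "\<dots> = emeasure ?P A"
        unfolding A using J X by (intro P.emeasure_PiM_emb[symmetric]) auto
      finally show ?thesis by (simp add: mult.commute)
    qed
    then show ?case using J by (intro exI[of _ J]) (auto intro: countable_finite)
  next
    case empty
    show ?case by auto
  next
    case (compl A)
    then obtain K where K: "countable K" "\<And>j D. j \<in> I - K \<Longrightarrow> D \<in> sets N \<Longrightarrow>
      emeasure ?P (A \<inter> C j D) = emeasure ?P A * emeasure N D" by blast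
    have A: "A \<in> sets ?P" using compl sig by simp
    have "emeasure ?P (((\<Pi>\<^sub>E i\<in>I. space N) - A) \<inter> C j D) =
        emeasure ?P ((\<Pi>\<^sub>E i\<in>I. space N) - A) * emeasure N D"
      if j: "j \<in> I - K" and D: "D \<in> sets N" for j D
    proof -
      have *: "((\<Pi>\<^sub>E i\<in>I. space N) - A) \<inter> C j D = C j D - A \<inter> C j D"
        by (auto simp: C_def space_PiM)
      have "measure ?P (C j D - A \<inter> C j D) = measure ?P (C j D) - measure ?P (A \<inter> C j D)"
        using A C_sets j D by (intro P.finite_measure_Diff) auto
      also have "measure ?P (C j D) = measure N D" using C_em[of j D] j D by (simp add: measure_def)
      also have "measure ?P (A \<inter> C j D) = measure ?P A * measure N D"
        using K(2)[OF j D] by (simp add: measure_def enn2real_mult)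
      also have "measure N D - measure ?P A * measure N D = (1 - measure ?P A) * measure N D"
        by (simp add: algebra_simps)
      also have "1 - measure ?P A = measure ?P (space ?P - A)"
        using A by (simp add: P.prob_compl)
      finally show ?thesis
        unfolding * by (simp add: P.emeasure_eq_measure N.emeasure_eq_measure space_PiM flip: ennreal_mult)
    qed
    then show ?case using K(1) by blast
  next
    case (union A)
    then obtain K where K: "\<And>i::nat. countable (K i)" "\<And>i j D. j \<in> I - K i \<Longrightarrow> D \<in> sets N \<Longrightarrow>
      emeasure ?P (A i \<inter> C j D) = emeasure ?P (A i) * emeasure N D" by metis
    have A: "range A \<subseteq> sets ?P" using union sig by simp
    have "emeasure ?P ((\<Union>i. A i) \<inter> C j D) = emeasure ?P (\<Union>i. A i) * emeasure N D"
      if j: "j \<in> I - (\<Union>i. K i)" and D: "D \<in> sets N" for j D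
    proof -
      have "emeasure ?P ((\<Union>i. A i) \<inter> C j D) = emeasure ?P (\<Union>i. A i \<inter> C j D)"
        by (simp add: Int_UN_distrib2)
      also have "\<dots> = (\<Sum>i. emeasure ?P (A i \<inter> C j D))"
        using union A C_sets j D by (intro suminf_emeasure[symmetric]) (auto simp: disjoint_family_on_def)
      also have "\<dots> = (\<Sum>i. emeasure ?P (A i) * emeasure N D)"
        using K(2) j D by simp
      also have "\<dots> = emeasure ?P (\<Union>i. A i) * emeasure N D"
        using union(1) A by (simp add: ennreal_suminf_multc suminf_emeasure)
      finally show ?thesis .
    qed
    then show ?case using K(1) by (intro exI[of _ "\<Union>i. K i"]) auto
  qed
  then show ?thesis unfolding C_def .
qed

lemma distr_PiM_componentwise:
  assumes N: "prob_space N" and f: "\<And>i. i \<in> I \<Longrightarrow> f i \<in> N \<rightarrow>\<^sub>M N" "\<And>i. i \<in> I \<Longrightarrow> distr N N (f i) = N"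
  shows "distr (PiM I (\<lambda>_. N)) (PiM I (\<lambda>_. N)) (\<lambda>\<omega>. \<lambda>i\<in>I. f i (\<omega> i)) = PiM I (\<lambda>_. N)"
proof -
  interpret N: prob_space N by fact
  interpret P: product_prob_space "\<lambda>_. N" I by standard
  let ?P = "PiM I (\<lambda>_. N)"
  have m: "(\<lambda>\<omega>. \<lambda>i\<in>I. f i (\<omega> i)) \<in> ?P \<rightarrow>\<^sub>M ?P"
    using f(1) by (intro measurable_restrict measurable_compose[OF measurable_component_singleton])
  show ?thesis
  proof (rule P.PiM_eq)
    fix J F assume J: "finite J" "J \<subseteq> I" and F: "\<And>j. j \<in> J \<Longrightarrow> F j \<in> sets N"
    let ?F = "\<lambda>j. f j -` F j \<inter> space N"
    have "emeasure (distr ?P ?P (\<lambda>\<omega>. \<lambda>i\<in>I. f i (\<omega> i))) (prod_emb I (\<lambda>_. N) J (Pi\<^sub>E J F)) =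
      emeasure ?P ((\<lambda>\<omega>. \<lambda>i\<in>I. f i (\<omega> i)) -` prod_emb I (\<lambda>_. N) J (Pi\<^sub>E J F) \<inter> space ?P)"
      using J F m by (intro emeasure_distr) (auto intro!: sets_PiM_I)
    also have "(\<lambda>\<omega>. \<lambda>i\<in>I. f i (\<omega> i)) -` prod_emb I (\<lambda>_. N) J (Pi\<^sub>E J F) \<inter> space ?P =
        prod_emb I (\<lambda>_. N) J (Pi\<^sub>E J ?F)"
      using J measurable_space[OF f(1)]
      by (fastforce simp: prod_emb_def space_PiM PiE_iff restrict_def extensional_def split: if_splits)
    also have "emeasure ?P \<dots> = (\<Prod>j\<in>J. emeasure N (?F j))"
      using J F f(1) by (intro P.emeasure_PiM_emb measurable_sets) auto
    also have "\<dots> = (\<Prod>j\<in>J. emeasure N (F j))"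
    proof (rule prod.cong)
      fix j assume j: "j \<in> J"
      then have "emeasure (distr N N (f j)) (F j) = emeasure N (?F j)"
        using J F f(1) by (intro emeasure_distr) auto
      then show "emeasure N (?F j) = emeasure N (F j)" using f(2) J j by auto
    qed simp
    finally show "emeasure (distr ?P ?P (\<lambda>\<omega>. \<lambda>i\<in>I. f i (\<omega> i))) (prod_emb I (\<lambda>_. N) J (Pi\<^sub>E J F)) =
      (\<Prod>j\<in>J. emeasure N (F j))" .
  qed simp
qed

section \<open>Pulling a measure back modulo countable sets\<close>

text \<open>
  The range of \<open>h\<close> need not be measurable. The set \<open>B\<close> is unique under the assumptions of \<open>thick_map\<close>
  below; otherwise \<open>THE\<close> may yield junk.
\<close>

definition pullback_measure :: "('g \<Rightarrow> 'p) \<Rightarrow> 'p measure \<Rightarrow> 'g measure" where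
  "pullback_measure h N = measure_of UNIV
     {A. \<exists>B\<in>sets N. countable (sym_diff A (h -` B))}
     (\<lambda>A. emeasure N (THE B. B \<in> sets N \<and> countable (sym_diff A (h -` B))))"

locale thick_map =
  fixes h :: "'g \<Rightarrow> 'p" and N :: "'p measure"
  assumes into: "range h \<subseteq> space N"
    and thick: "\<And>B. B \<in> sets N \<Longrightarrow> countable (h -` B) \<Longrightarrow> B = {}"
begin

abbreviation "pull \<equiv> pullback_measure h N"

text \<open>Two candidates differ by a measurable set with countable preimage, and
  \<open>thick\<close> leaves only the empty one.\<close>

lemma unique_representative:
  assumes "B \<in> sets N" "B' \<in> sets N" "countable (sym_diff A (h -` B))" "countable (sym_diff A (h -` B'))"
  shows "B = B'"
proof -
  have "h -` sym_diff B B' \<subseteq> sym_diff A (h -` B) \<union> sym_diff A (h -` B')" by auto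
  then have "countable (h -` sym_diff B B')"
    by (rule countable_subset) (use assms in \<open>simp only: countable_Un_iff simp_thms\<close>)
  then have "sym_diff B B' = {}" by (rule thick[rotated]) (use assms in auto)
  then show ?thesis by auto
qed

lemma sigma_algebra: "sigma_algebra UNIV {A. \<exists>B\<in>sets N. countable (sym_diff A (h -` B))}"
proof (rule sigma_algebra_iff2[THEN iffD2], safe)
  show "\<exists>B\<in>sets N. countable (sym_diff {} (h -` B))" by (rule bexI[of _ "{}"]) auto
next
  fix s B assume B: "B \<in> sets N" "countable (sym_diff s (h -` B))"
  have "sym_diff (UNIV - s) (h -` (space N - B)) = sym_diff s (h -` B)" using into by auto
  then show "\<exists>B\<in>sets N. countable (sym_diff (UNIV - s) (h -` B))"
    using B by (intro bexI[of _ "space N - B"]) auto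
next
  fix A :: "nat \<Rightarrow> 'g set" assume "range A \<subseteq> {A. \<exists>B\<in>sets N. countable (sym_diff A (h -` B))}"
  then have "\<forall>i. \<exists>B\<in>sets N. countable (sym_diff (A i) (h -` B))" by blast
  then obtain B where B: "\<And>i. B i \<in> sets N" "\<And>i. countable (sym_diff (A i) (h -` B i))" by metis
  have "sym_diff (\<Union>i. A i) (h -` (\<Union>i. B i)) \<subseteq> (\<Union>i. sym_diff (A i) (h -` B i))" by auto
  then have "countable (sym_diff (\<Union>i. A i) (h -` (\<Union>i. B i)))"
    by (rule countable_subset) (use B(2) in \<open>intro countable_UN countableI_type\<close>)
  then show "\<exists>B\<in>sets N. countable (sym_diff (\<Union>i. A i) (h -` B))" using B by blast
qed simp

lemma sets_pullback: "sets pull = {A. \<exists>B\<in>sets N. countable (sym_diff A (h -` B))}"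
  unfolding pullback_measure_def using sigma_algebra.sigma_sets_eq[OF sigma_algebra] by simp

lemma space_pullback: "space pull = UNIV"
  unfolding pullback_measure_def by simp

text \<open>Representatives of disjoint sets are disjoint outright, not merely up to a null set,
  because their intersection has countable preimage. Countable additivity is therefore inherited
  from \<open>N\<close>.\<close>

lemma emeasure_pullback:
  assumes B: "B \<in> sets N" "countable (sym_diff A (h -` B))"
  shows "emeasure pull A = emeasure N B"
proof -
  define rep where "rep A = (THE B. B \<in> sets N \<and> countable (sym_diff A (h -` B)))" for A
  have rep: "rep A = B" if "B \<in> sets N" "countable (sym_diff A (h -` B))" for A B
    unfolding rep_def
  proof (rule the_equality)
    fix B' assume "B' \<in> sets N \<and> countable (sym_diff A (h -` B'))"
    then show "B' = B" using unique_representative[OF _ that(1) _ that(2)] by simp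
  qed (rule conjI[OF that])
  let ?S = "{A. \<exists>B\<in>sets N. countable (sym_diff A (h -` B))}"
  have ca: "countably_additive ?S (\<lambda>A. emeasure N (rep A))"
  proof (rule countably_additiveI)
    fix A :: "nat \<Rightarrow> 'g set" assume A: "range A \<subseteq> ?S" "disjoint_family A"
    then have "\<forall>i. \<exists>B\<in>sets N. countable (sym_diff (A i) (h -` B))" by blast
    then obtain B where B: "\<And>i. B i \<in> sets N" "\<And>i. countable (sym_diff (A i) (h -` B i))" by metis
    have "B i \<inter> B j = {}" if "i \<noteq> j" for i j
    proof (rule thick)
      have "h -` (B i \<inter> B j) \<subseteq> sym_diff (A i) (h -` B i) \<union> sym_diff (A j) (h -` B j)"
        using A(2) that by (auto simp: disjoint_family_on_def)
      then show "countable (h -` (B i \<inter> B j))"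
        by (rule countable_subset) (use B(2) in \<open>simp only: countable_Un_iff simp_thms\<close>)
    qed (use B in auto)
    then have "disjoint_family B" by (auto simp: disjoint_family_on_def)
    then have "(\<Sum>i. emeasure N (B i)) = emeasure N (\<Union>i. B i)"
      using B by (intro suminf_emeasure) auto
    moreover have "rep (\<Union>i. A i) = (\<Union>i. B i)"
    proof (rule rep)
      have "sym_diff (\<Union>i. A i) (h -` (\<Union>i. B i)) \<subseteq> (\<Union>i. sym_diff (A i) (h -` B i))" by auto
      then show "countable (sym_diff (\<Union>i. A i) (h -` (\<Union>i. B i)))"
        by (rule countable_subset) (use B(2) in \<open>intro countable_UN countableI_type\<close>)
    qed (use B in auto)
    ultimately show "(\<Sum>i. emeasure N (rep (A i))) = emeasure N (rep (\<Union>i. A i))"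
      using rep[OF B] by simp
  qed
  have "emeasure pull A = emeasure N (rep A)"
    unfolding pullback_measure_def rep_def[symmetric]
  proof (rule emeasure_measure_of_sigma)
    show "sigma_algebra UNIV ?S" by (rule sigma_algebra)
    show "positive ?S (\<lambda>A. emeasure N (rep A))" using rep[of "{}" "{}"] by (simp add: positive_def)
    show "countably_additive ?S (\<lambda>A. emeasure N (rep A))" by (rule ca)
    show "A \<in> ?S" using B by blast
  qed
  then show ?thesis using rep[OF B] by simp
qed

lemma measurable_h: "h \<in> pull \<rightarrow>\<^sub>M N"
proof (rule measurableI)
  fix A assume "A \<in> sets N"
  then show "h -` A \<inter> space pull \<in> sets pull"
    by (auto simp: space_pullback sets_pullback intro!: bexI[of _ A])
qed (use into in auto)

lemma distr_h: "distr pull N h = N"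
proof (rule measure_eqI)
  fix A assume "A \<in> sets (distr pull N h)"
  then show "emeasure (distr pull N h) A = emeasure N A"
    by (simp add: emeasure_distr[OF measurable_h] space_pullback) (rule emeasure_pullback; simp)
qed simp

lemma countable_null: "countable A \<Longrightarrow> A \<in> null_sets pull"
  using emeasure_pullback[of "{}" A] by (auto simp: null_sets_def sets_pullback intro!: bexI[of _ "{}"])

lemma prob_space_pullback: "prob_space N \<Longrightarrow> prob_space pull"
  using prob_space_distrD[OF measurable_h] distr_h by simp

text \<open>If \<open>B\<close> represents \<open>A\<close>, then the \<open>q\<close>-preimage of
  \<open>B\<close> represents the \<open>t\<close>-preimage of \<open>A\<close>: the exceptional
  points pull back along the injective \<open>t\<close> to a countable set.\<close>

lemma distr_pullback_self:
  assumes q: "q \<in> N \<rightarrow>\<^sub>M N" "distr N N q = N" and t: "inj t" "\<And>g. h (t g) = q (h g)"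
  shows "t \<in> pull \<rightarrow>\<^sub>M pull" "distr pull pull t = pull"
proof -
  have *: "q -` B \<inter> space N \<in> sets N \<and> countable (sym_diff (t -` A) (h -` (q -` B \<inter> space N)))"
    if "B \<in> sets N" "countable (sym_diff A (h -` B))" for A B
  proof -
    have "sym_diff (t -` A) (h -` (q -` B \<inter> space N)) = t -` sym_diff A (h -` B)"
      using into t(2) by auto
    moreover have "countable (t -` sym_diff A (h -` B))"
      using countable_image_inj_Int_vimage[OF t(1) that(2)] by simp
    ultimately show ?thesis using that(1) q by (simp add: measurable_sets)
  qed
  show m: "t \<in> pull \<rightarrow>\<^sub>M pull"
  proof (rule measurableI)
    fix A assume "A \<in> sets pull"
    then obtain B where "B \<in> sets N" "countable (sym_diff A (h -` B))" unfolding sets_pullback by blast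
    from *[OF this] show "t -` A \<inter> space pull \<in> sets pull"
      unfolding space_pullback sets_pullback Int_UNIV_right by blast
  qed (simp add: space_pullback)
  show "distr pull pull t = pull"
  proof (rule measure_eqI)
    fix A assume A: "A \<in> sets (distr pull pull t)"
    then obtain B where B: "B \<in> sets N" "countable (sym_diff A (h -` B))"
      unfolding sets_distr sets_pullback by blast
    have "emeasure (distr pull pull t) A = emeasure pull (t -` A)"
      using A by (simp add: emeasure_distr[OF m] space_pullback)
    also have "\<dots> = emeasure N (q -` B \<inter> space N)" using *[OF B] by (intro emeasure_pullback) auto
    also have "\<dots> = emeasure (distr N N q) B" using B q(1) by (simp add: emeasure_distr)
    also have "\<dots> = emeasure pull A" unfolding q(2) by (rule emeasure_pullback[OF B, symmetric])
    finally show "emeasure (distr pull pull t) A = emeasure pull A" .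
  qed simp
qed

end

section \<open>Coding by sets of natural numbers\<close>

text \<open>Packs countably many sets of numbers into one by pairing, so that sequences over a type
  of at most continuum size again fit into \<open>nat set\<close>.\<close>

definition seq_code :: "(nat \<Rightarrow> nat set) \<Rightarrow> nat set" where
  "seq_code F = {prod_encode (n, k) | n k. k \<in> F n}"

lemma inj_seq_code: "inj seq_code"
proof (rule injI, rule ext)
  fix F G :: "nat \<Rightarrow> nat set" and n assume "seq_code F = seq_code G"
  moreover have "k \<in> H n \<longleftrightarrow> prod_encode (n, k) \<in> seq_code H" for H k
    by (auto simp: seq_code_def)
  ultimately show "F n = G n" by blast
qed

lemma embed_fun_nat_set:
  fixes f :: "'c \<Rightarrow> nat set"
  assumes "inj f"
  shows "inj (\<lambda>F :: 'd::countable \<Rightarrow> 'c. seq_code (\<lambda>n. f (F (from_nat n))))"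
proof (rule injI, rule ext)
  fix F G :: "'d \<Rightarrow> 'c" and x :: 'd
  assume "seq_code (\<lambda>n. f (F (from_nat n))) = seq_code (\<lambda>n. f (G (from_nat n)))"
  then have "(\<lambda>n. f (F (from_nat n))) = (\<lambda>n. f (G (from_nat n)))" by (rule injD[OF inj_seq_code])
  from fun_cong[OF this, of "to_nat x"] show "F x = G x" by (simp add: inj_eq[OF assms])
qed

lemma embed_pair_nat_set:
  fixes f :: "'c \<Rightarrow> nat set" and g :: "'d \<Rightarrow> nat set"
  assumes "inj f" "inj g"
  shows "inj (\<lambda>(x, y). seq_code (\<lambda>n. if n = 0 then f x else g y))"
proof (rule injI, clarify)
  fix x y x' y'
  assume "seq_code (\<lambda>n. if n = 0 then f x else g y) = seq_code (\<lambda>n. if n = 0 then f x' else g y')"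
  then have *: "(\<lambda>n. if n = 0 then f x else g y) = (\<lambda>n. if n = (0::nat) then f x' else g y')"
    by (rule injD[OF inj_seq_code])
  show "x = x' \<and> y = y'"
    using fun_cong[OF *, of 0] fun_cong[OF *, of 1] assms[THEN injD] by auto
qed

lemma embed_real_nat_set: "\<exists>f :: real \<Rightarrow> nat set. bij f"
  using eqpoll_sym[OF nat_sets_eqpoll_reals] unfolding eqpoll_def .

lemma embed_int_nat_set: "inj (\<lambda>n :: int. {to_nat n})"
  by (auto intro!: injI)

text \<open>A point is coded by the members of a countable basis that contain it; the T0 property
  makes the code injective.\<close>

lemma embed_second_countable_nat_set:
  "\<exists>f :: 'b::{second_countable_topology, t0_space} \<Rightarrow> nat set. inj f"
proof -
  obtain B :: "'b set set" where B: "countable B" "topological_basis B"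
    using ex_countable_basis by (elim exE conjE)
  have "inj (\<lambda>x::'b. {n. x \<in> from_nat_into B n})"
  proof (rule injI)
    fix x y :: 'b
    assume eq: "{n. x \<in> from_nat_into B n} = {n. y \<in> from_nat_into B n}"
    have same: "x \<in> b \<longleftrightarrow> y \<in> b" if "b \<in> B" for b
    proof -
      have "\<exists>n. from_nat_into B n = b" by (rule from_nat_into_surj[OF B(1) that])
      then show ?thesis using eq by (auto simp: set_eq_iff)
    qed
    have "x \<in> U \<longleftrightarrow> y \<in> U" if U: "open U" for U
    proof -
      obtain B' where "B' \<subseteq> B" "U = \<Union>B'"
        using B(2) U unfolding topological_basis_def by auto
      then show ?thesis using same by blast
    qed
    then show "x = y" using separation_t0[of x y] by blast
  qed
  then show ?thesis by (intro exI)
qed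

text \<open>All sequences of prescriptions embed into the reals, even when paired with a real dummy
  parameter \<open>t\<close>. Inverting the embedding and forgetting \<open>t\<close> leaves
  uncountable fibres.\<close>

lemma ex_decoding:
  fixes c :: "'a \<Rightarrow> nat set"
  assumes "inj c"
  shows "\<exists>dec :: real \<Rightarrow> nat \<Rightarrow> nat \<times> (nat \<Rightarrow> real) \<times> 'a. \<forall>s. uncountable {u. dec u = s}"
proof -
  obtain r :: "real \<Rightarrow> nat set" where r: "bij r" using embed_real_nat_set by blast
  then have ir: "inj r" by (simp add: bij_is_inj)
  have in_: "inj (\<lambda>n :: nat. {n})" by (auto intro!: injI)
  note p = embed_pair_nat_set[OF embed_fun_nat_set[OF embed_pair_nat_set[OF in_
        embed_pair_nat_set[OF embed_fun_nat_set[OF ir] assms]]] ir]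
  obtain k :: "(nat \<Rightarrow> nat \<times> (nat \<Rightarrow> real) \<times> 'a) \<times> real \<Rightarrow> nat set" where k: "inj k"
    using p by blast
  define h where "h = inv r \<circ> k"
  have h: "inj h"
    unfolding h_def by (rule inj_compose[OF bij_is_inj[OF bij_imp_bij_inv[OF r]] k])
  have "uncountable {u. fst (inv h u) = s}" for s
  proof
    assume "countable {u. fst (inv h u) = s}"
    moreover have "range (\<lambda>t. h (s, t)) \<subseteq> {u. fst (inv h u) = s}" using h by auto
    ultimately have "countable (range (\<lambda>t. h (s, t)))" using countable_subset by blast
    then have "countable (UNIV :: real set)"
      by (rule countable_image_inj_on) (use h in \<open>auto simp: inj_on_def\<close>)
    then show False using uncountable_UNIV_real by simp
  qed
  then show ?thesis by (intro exI[of _ "\<lambda>u. fst (inv h u)"] allI)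
qed

lemma ex_embedding_point: "\<exists>e :: real \<times> int \<Rightarrow> point. inj e"
proof -
  obtain r :: "real \<Rightarrow> nat set" where r: "inj r" using embed_real_nat_set bij_is_inj by blast
  obtain k :: "real \<times> int \<Rightarrow> nat set" where k: "inj k"
    using embed_pair_nat_set[OF r embed_int_nat_set] by blast
  \<comment> \<open>Replacing each number by a constant function embeds \<open>nat set\<close> into
    \<open>point\<close>.\<close>
  have "inj (\<lambda>x. (\<lambda>n m :: nat. n) ` k x :: point)"
  proof (rule injI)
    fix x y assume "(\<lambda>n m :: nat. n) ` k x = (\<lambda>n m. n) ` k y"
    moreover have "inj (\<lambda>n m :: nat. n)" by (auto intro!: injI dest: fun_cong)
    ultimately have "k x = k y" by (metis inj_image_eq_iff)
    then show "x = y" using k by (simp add: injD)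
  qed
  then show ?thesis by blast
qed

section \<open>A generic function on the real cube\<close>

declare One_nat_def [simp del]

definition unit_vec :: "nat \<Rightarrow> int \<Rightarrow> nat \<Rightarrow> int" where
  "unit_vec k n i = (if i = k then n else 0)"

text \<open>The triples coded by \<open>dec\<close> consist of a direction, a line in that direction
  and a value. All of \<open>nat \<Rightarrow> int\<close> acts, so that exponents add pointwise
  without a condition on their support.\<close>

locale generic_cube =
  fixes l :: nat and \<nu> :: "'a measure" and act :: "(nat \<Rightarrow> int) \<Rightarrow> 'a \<Rightarrow> 'a"
    and dec :: "real \<Rightarrow> nat \<Rightarrow> nat \<times> (nat \<Rightarrow> real) \<times> 'a"
    and e :: "real \<times> int \<Rightarrow> 'x"
  assumes l_pos: "0 < l"
    and prob_nu: "prob_space \<nu>"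
    and space_nu: "space \<nu> = UNIV"
    and act_zero: "act (\<lambda>_. 0) a = a"
    and act_add: "act m (act m' a) = act (\<lambda>i. m i + m' i) a"
    and act_measurable[measurable]: "act m \<in> \<nu> \<rightarrow>\<^sub>M \<nu>"
    and distr_act: "distr \<nu> \<nu> (act m) = \<nu>"
    and uncountable_dec: "uncountable {u. dec u = s}"
    and inj_e: "inj e"
begin

abbreviation "L \<equiv> {1..l}"

text \<open>The coordinate sum selects a list of prescriptions, and the first entry whose line
  passes through \<open>w\<close> supplies the value; if there is none, the value is unspecified. An
  axis-parallel line contains exactly one tuple with a given sum, so an entry concerns a single
  point of its line.\<close>

definition \<Psi> :: "(nat \<Rightarrow> real) \<Rightarrow> 'a" where
  "\<Psi> w = (let c = dec (\<Sum>i\<in>L. w i) in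
     snd (snd (c (LEAST n. fst (c n) \<in> L \<and> (\<forall>i\<in>L - {fst (c n)}. fst (snd (c n)) i = w i)))))"

text \<open>The base point is an extensional function without the moving coordinate, which gives
  every line exactly one name.\<close>

definition lines :: "(nat \<times> (nat \<Rightarrow> real)) set" where
  "lines = (SIGMA k:L. PiE (L - {k}) (\<lambda>_. UNIV))"

text \<open>These are the values of the map \<open>\<Phi>\<close> below at the points with
  coordinate sum \<open>g\<close> on all lines whose fixed coordinates have integer part 0. Other
  lines are reduced to these by \<open>Phi_ins\<close>.\<close>

definition \<Gamma> :: "real \<times> int \<Rightarrow> nat \<times> (nat \<Rightarrow> real) \<Rightarrow> 'a" where
  "\<Gamma> g = (\<lambda>(k, w)\<in>lines.
     act (unit_vec k (snd g)) (\<Psi> (w(k := fst g - (\<Sum>i\<in>L - {k}. w i)))))"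

abbreviation N :: "(nat \<times> (nat \<Rightarrow> real) \<Rightarrow> 'a) measure" where
  "N \<equiv> PiM lines (\<lambda>_. \<nu>)"

abbreviation \<Lambda> :: "(real \<times> int) measure" where
  "\<Lambda> \<equiv> pullback_measure \<Gamma> N"

lemma unit_vec_0: "unit_vec k 0 = (\<lambda>_. 0)"
  by (auto simp: unit_vec_def)

lemma emeasure_act: "D \<in> sets \<nu> \<Longrightarrow> emeasure \<nu> (act m -` D) = emeasure \<nu> D"
  using emeasure_distr[OF act_measurable[of m], of D] unfolding distr_act by (simp add: space_nu)

lemma act_vimage: "D \<in> sets \<nu> \<Longrightarrow> act m -` D \<in> sets \<nu>"
  using measurable_sets[OF act_measurable] by (simp add: space_nu)

lemma Psi_cong: "(\<And>i. i \<in> L \<Longrightarrow> w i = w' i) \<Longrightarrow> \<Psi> w = \<Psi> w'"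
proof -
  assume *: "\<And>i. i \<in> L \<Longrightarrow> w i = w' i"
  then have "(\<Sum>i\<in>L. w i) = (\<Sum>i\<in>L. w' i)" by (intro sum.cong) auto
  moreover have "(k \<in> L \<and> (\<forall>i\<in>L - {k}. f i = w i)) = (k \<in> L \<and> (\<forall>i\<in>L - {k}. f i = w' i))" for k f
    using * by auto
  ultimately show ?thesis unfolding \<Psi>_def Let_def by presburger
qed

lemma sum_upd: "k \<in> L \<Longrightarrow> (\<Sum>i\<in>L. f ((w(k := a)) i)) = f a + (\<Sum>i\<in>L - {k}. f (w i))"
  for f :: "'c \<Rightarrow> 'd::comm_monoid_add"
  by (subst sum.remove[of _ k]) (auto intro!: sum.cong)

text \<open>
  The number \<open>u\<close> is read as a list of prescriptions \<open>(k, w, y)\<close> for the values of \<open>\<Psi>\<close> on the tuples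
  with sum \<open>u\<close>. Prescriptions in the same direction never clash, and prescriptions in different
  directions clash only for countably many \<open>u\<close>.
\<close>

lemma prescribe:
  assumes J: "countable J" "J \<subseteq> lines"
  shows "uncountable {u. \<forall>(k, w)\<in>J. \<Psi> (w(k := u - (\<Sum>i\<in>L - {k}. w i))) = \<eta> (k, w)}"
    (is "uncountable ?U")
proof (cases "J = {}")
  case True
  then show ?thesis using uncountable_UNIV_real by simp
next
  case False
  define s where "s n = (case from_nat_into J n of (k, w) \<Rightarrow> (k, w, \<eta> (k, w)))" for n
  \<comment> \<open>If an entry \<open>(k0, w0)\<close> of another direction meets the point of the
    line \<open>(k, w)\<close> with sum \<open>u\<close>, then \<open>w0 k\<close> is the k-th
    coordinate of that point and thereby determines \<open>u\<close>. The set \<open>bad\<close>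
    collects all such sums.\<close>
  define bad where "bad = (\<lambda>((k, w), (k', w')). w' k + (\<Sum>i\<in>L - {k}. w i)) ` (J \<times> J)"
  have bad: "countable bad" unfolding bad_def using J by auto
  have "{u. dec u = s} - bad \<subseteq> ?U"
  proof clarify
    fix u k w assume u: "u \<notin> bad" "s = dec u" and kw: "(k, w) \<in> J"
    let ?x = "w(k := u - (\<Sum>i\<in>L - {k}. w i))"
    let ?c = "\<lambda>n. fst (s n) \<in> L \<and> (\<forall>i\<in>L - {fst (s n)}. fst (snd (s n)) i = ?x i)"
    have k: "k \<in> L" and w: "w \<in> PiE (L - {k}) (\<lambda>_. UNIV)" using kw J by (auto simp: lines_def)
    have sum: "(\<Sum>i\<in>L. ?x i) = u" unfolding sum_upd[OF k, of "\<lambda>x. x"] by simp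
    obtain n where n: "from_nat_into J n = (k, w)" using from_nat_into_surj[OF J(1) kw] by blast
    have cn: "?c n" using k by (auto simp: s_def n)
    define m where "m = Least ?c"
    have m: "?c m" unfolding m_def by (rule LeastI[of ?c, OF cn])
    obtain k0 w0 where 0: "from_nat_into J m = (k0, w0)" by (cases "from_nat_into J m")
    have J0: "(k0, w0) \<in> J" using from_nat_into[OF False, of m] 0 by simp
    have s0: "s m = (k0, w0, \<eta> (k0, w0))" by (simp add: s_def 0)
    have c0: "\<forall>i\<in>L - {k0}. w0 i = ?x i" using m unfolding s0 by simp
    have "k0 = k"
    proof (rule ccontr)
      assume "k0 \<noteq> k"
      then have "w0 k = u - (\<Sum>i\<in>L - {k}. w i)" using c0 k by auto
      then have "u = w0 k + (\<Sum>i\<in>L - {k}. w i)" by simp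
      then have "u \<in> bad" unfolding bad_def using kw J0 by force
      then show False using u by simp
    qed
    moreover have "w0 = w"
    proof (rule PiE_ext)
      show "w0 \<in> PiE (L - {k}) (\<lambda>_. UNIV)" using J0 J \<open>k0 = k\<close> by (auto simp: lines_def)
      show "w \<in> PiE (L - {k}) (\<lambda>_. UNIV)" by (rule w)
      show "w0 i = w i" if "i \<in> L - {k}" for i using c0 that \<open>k0 = k\<close> by auto
    qed
    ultimately show "\<Psi> ?x = \<eta> (k, w)"
      unfolding \<Psi>_def sum Let_def u(2)[symmetric] m_def[symmetric] s0 by simp
  qed
  then show ?thesis
    using uncountable_minus_countable[OF uncountable_dec[of s] bad] countable_subset by blast
qed

lemma Gamma_apply:
  "(k, w) \<in> lines \<Longrightarrow> \<Gamma> g (k, w) = act (unit_vec k (snd g)) (\<Psi> (w(k := fst g - (\<Sum>i\<in>L - {k}. w i))))"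
  by (simp add: \<Gamma>_def)

text \<open>Membership in a measurable \<open>B\<close> is decided on countably many lines. By
  \<open>prescribe\<close>, the values of any one member of \<open>B\<close> occur on these lines
  for uncountably many sums \<open>u\<close>, and each such \<open>(u, 0)\<close> lies in the
  preimage.\<close>

sublocale thick_map \<Gamma> N
proof
  show "range \<Gamma> \<subseteq> space N" by (auto simp: \<Gamma>_def space_PiM space_nu)
next
  fix B assume B: "B \<in> sets N" "countable (\<Gamma> -` B)"
  obtain J where J: "countable J" "J \<subseteq> lines"
    "\<forall>x\<in>space N. \<forall>y\<in>space N. (\<forall>j\<in>J. x j = y j) \<longrightarrow> (x \<in> B \<longleftrightarrow> y \<in> B)"
    using PiM_countable_support[OF B(1)] by (elim exE conjE)
  show "B = {}"
  proof (rule ccontr)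
    assume "B \<noteq> {}"
    then obtain \<omega> where \<omega>: "\<omega> \<in> B" by blast
    define U where "U = {u. \<forall>(k, w)\<in>J. \<Psi> (w(k := u - (\<Sum>i\<in>L - {k}. w i))) = \<omega> (k, w)}"
    have "uncountable U" unfolding U_def using J by (intro prescribe)
    moreover have "(\<lambda>u. (u, 0)) ` U \<subseteq> \<Gamma> -` B"
    proof (rule image_subsetI)
      fix u assume u: "u \<in> U"
      have "\<Gamma> (u, 0) j = \<omega> j" if "j \<in> J" for j
      proof -
        obtain k w where j: "j = (k, w)" by (cases j)
        have "(k, w) \<in> lines" using that J(2) j by blast
        moreover have "\<Psi> (w(k := u - (\<Sum>i\<in>L - {k}. w i))) = \<omega> (k, w)"
          using u that unfolding U_def j by blast
        ultimately show ?thesis by (simp add: Gamma_apply j unit_vec_0 act_zero)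
      qed
      moreover have "\<Gamma> (u, 0) \<in> space N" by (auto simp: \<Gamma>_def space_PiM space_nu)
      moreover have "\<omega> \<in> space N" using \<omega> B(1) sets.sets_into_space by blast
      ultimately show "(u, 0) \<in> \<Gamma> -` B" unfolding vimage_eq using J(3) \<omega> by blast
    qed
    ultimately show False
      using B(2) countable_subset countable_image_inj_on[of "\<lambda>u. (u, 0::int)" U]
      by (auto simp: inj_on_def)
  qed
qed

section \<open>Invariance and independence of the values along lines\<close>

lemma prob_Lambda: "prob_space \<Lambda>"
  by (rule prob_space_pullback) (rule prob_space_PiM[OF prob_nu])

text \<open>Raising the integer part of the sum by \<open>n\<close> applies
  \<open>act (unit_vec k n)\<close> to the value on each line of direction \<open>k\<close>. This
  preserves the product measure componentwise, and the pullback inherits the invariance.\<close>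

lemma Lambda_shift:
  "(\<lambda>g. g + (0, n)) \<in> \<Lambda> \<rightarrow>\<^sub>M \<Lambda>" "distr \<Lambda> \<Lambda> (\<lambda>g. g + (0, n)) = \<Lambda>"
proof -
  let ?q = "\<lambda>\<omega>. \<lambda>j\<in>lines. act (unit_vec (fst j) n) (\<omega> j)"
  have q: "?q \<in> N \<rightarrow>\<^sub>M N"
    by (intro measurable_restrict measurable_compose[OF _ act_measurable] measurable_component_singleton)
  have d: "distr N N ?q = N" by (intro distr_PiM_componentwise prob_nu act_measurable distr_act)
  have i: "inj (\<lambda>g :: real \<times> int. g + (0, n))" by (auto intro: injI)
  have "\<Gamma> (g + (0, n)) = ?q (\<Gamma> g)" for g
    by (auto simp: \<Gamma>_def restrict_def fun_eq_iff act_add intro!: arg_cong[of _ _ "\<lambda>m. act m _"])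
       (auto simp: unit_vec_def)
  from distr_pullback_self[OF q d i this]
  show "(\<lambda>g. g + (0, n)) \<in> \<Lambda> \<rightarrow>\<^sub>M \<Lambda>" "distr \<Lambda> \<Lambda> (\<lambda>g. g + (0, n)) = \<Lambda>" .
qed

lemma Gamma_component_measurable: "j \<in> lines \<Longrightarrow> (\<lambda>g. \<Gamma> g j) \<in> \<Lambda> \<rightarrow>\<^sub>M \<nu>"
  by (rule measurable_compose[OF measurable_h measurable_component_singleton])

lemma emeasure_Gamma_component:
  assumes "j \<in> lines" "D \<in> sets \<nu>"
  shows "emeasure \<Lambda> {g. \<Gamma> g j \<in> D} = emeasure \<nu> D"
proof -
  have "distr N \<nu> (\<lambda>\<omega>. \<omega> j) = \<nu>" by (rule distr_PiM_component) (auto intro: prob_nu assms)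
  then have "distr \<Lambda> \<nu> (\<lambda>g. \<Gamma> g j) = \<nu>"
    using distr_distr[OF measurable_component_singleton[OF assms(1)] measurable_h] by (simp add: distr_h comp_def)
  then have "emeasure \<nu> D = emeasure (distr \<Lambda> \<nu> (\<lambda>g. \<Gamma> g j)) D" by simp
  also have "\<dots> = emeasure \<Lambda> {g. \<Gamma> g j \<in> D}"
    using assms by (simp add: emeasure_distr Gamma_component_measurable space_pullback vimage_def)
  finally show ?thesis by simp
qed

text \<open>Transfer of \<open>PiM_independent_component\<close> through a representative
  \<open>B\<close> of \<open>E\<close>: the intersections differ only where \<open>E\<close> and the
  preimage of \<open>B\<close> do.\<close>

lemma Lambda_independent_line:
  assumes "E \<in> sets \<Lambda>"
  shows "\<exists>K. countable K \<and> (\<forall>j\<in>lines - K. \<forall>D\<in>sets \<nu>.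
    emeasure \<Lambda> (E \<inter> {g. \<Gamma> g j \<in> D}) = emeasure \<Lambda> E * emeasure \<nu> D)"
proof -
  obtain B where B: "B \<in> sets N" "countable (sym_diff E (\<Gamma> -` B))"
    using assms unfolding sets_pullback by blast
  obtain K where K: "countable K" "\<forall>j\<in>lines - K. \<forall>D\<in>sets \<nu>.
    emeasure N (B \<inter> {\<omega> \<in> space N. \<omega> j \<in> D}) = emeasure N B * emeasure \<nu> D"
    using PiM_independent_component[OF prob_nu B(1)] by (elim exE conjE)
  have "emeasure \<Lambda> (E \<inter> {g. \<Gamma> g j \<in> D}) = emeasure \<Lambda> E * emeasure \<nu> D"
    if j: "j \<in> lines - K" and D: "D \<in> sets \<nu>" for j D
  proof -
    have C: "{\<omega> \<in> space N. \<omega> j \<in> D} \<in> sets N"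
      using measurable_sets[OF measurable_component_singleton[of j lines "\<lambda>_. \<nu>"] D] j
      by (simp add: vimage_def Int_def conj_commute)
    have "sym_diff (E \<inter> {g. \<Gamma> g j \<in> D}) (\<Gamma> -` (B \<inter> {\<omega> \<in> space N. \<omega> j \<in> D})) \<subseteq> sym_diff E (\<Gamma> -` B)"
      using into by auto
    then have "countable (sym_diff (E \<inter> {g. \<Gamma> g j \<in> D}) (\<Gamma> -` (B \<inter> {\<omega> \<in> space N. \<omega> j \<in> D})))"
      using B(2) by (rule countable_subset)
    from emeasure_pullback[OF _ this] B C
    have "emeasure \<Lambda> (E \<inter> {g. \<Gamma> g j \<in> D}) = emeasure N (B \<inter> {\<omega> \<in> space N. \<omega> j \<in> D})" by blast
    also have "\<dots> = emeasure N B * emeasure \<nu> D" using K j D by blast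
    also have "emeasure N B = emeasure \<Lambda> E" using emeasure_pullback[OF B] by simp
    finally show ?thesis .
  qed
  then show ?thesis using K(1) by blast
qed

end

section \<open>The measure on the cube\<close>

context generic_cube begin

definition d :: "'x \<Rightarrow> real \<times> int" where "d = inv e"

abbreviation X :: "'x set" where "X \<equiv> range e"

abbreviation P :: "(nat \<Rightarrow> 'x) set" where "P \<equiv> PiE L (\<lambda>_. X)"

abbreviation Z :: "nat \<Rightarrow> (nat \<Rightarrow> 'x) set" where "Z k \<equiv> PiE (L - {k}) (\<lambda>_. X)"

definition tot :: "(nat \<Rightarrow> 'x) \<Rightarrow> real \<times> int" where
  "tot x = (\<Sum>i\<in>L. d (x i))"

definition rest :: "nat \<Rightarrow> (nat \<Rightarrow> 'x) \<Rightarrow> real \<times> int" where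
  "rest k z = (\<Sum>i\<in>L - {k}. d (z i))"

text \<open>The line over \<open>z\<close>, parametrised by the coordinate sum instead of the k-th
  coordinate. In this parameter all lines can carry the same measure
  \<open>\<Lambda>\<close>.\<close>

definition ins :: "nat \<Rightarrow> (nat \<Rightarrow> 'x) \<Rightarrow> real \<times> int \<Rightarrow> nat \<Rightarrow> 'x" where
  "ins k z g = z(k := e (g - rest k z))"

definition \<Phi> :: "(nat \<Rightarrow> 'x) \<Rightarrow> 'a" where
  "\<Phi> x = act (\<lambda>i. if i \<in> L then snd (d (x i)) else 0) (\<Psi> (\<lambda>i. fst (d (x i))))"

definition line :: "nat \<Rightarrow> (nat \<Rightarrow> 'x) \<Rightarrow> nat \<times> (nat \<Rightarrow> real)" where
  "line k z = (k, \<lambda>i\<in>L - {k}. fst (d (z i)))"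

text \<open>The integer parts of a point on the line over \<open>z\<close>, except that entry
  \<open>k\<close> leaves out the contribution of the parameter \<open>g\<close>, which
  \<open>\<Gamma>\<close> already applies.\<close>

definition line_shift :: "nat \<Rightarrow> (nat \<Rightarrow> 'x) \<Rightarrow> nat \<Rightarrow> int" where
  "line_shift k z i = (if i = k then - snd (rest k z) else if i \<in> L then snd (d (z i)) else 0)"

lemma d_e [simp]: "d (e g) = g"
  by (simp add: d_def inj_e)

lemma e_d [simp]: "x \<in> X \<Longrightarrow> e (d x) = x"
  by (simp add: d_def f_inv_into_f)

lemma ins_mem: "k \<in> L \<Longrightarrow> z \<in> Z k \<Longrightarrow> ins k z g \<in> P"
  unfolding ins_def by (auto simp: PiE_iff extensional_def)

lemma tot_ins: "k \<in> L \<Longrightarrow> tot (ins k z g) = g"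
  unfolding tot_def ins_def by (simp only: sum_upd[of k d] rest_def) simp

lemma drop_ins: "k \<in> L \<Longrightarrow> z \<in> Z k \<Longrightarrow> drop_coord l k (ins k z g) = z"
  by (auto simp: drop_coord_def ins_def fun_eq_iff PiE_iff extensional_def restrict_def)

lemma drop_mem: "x \<in> P \<Longrightarrow> drop_coord l k x \<in> Z k"
  by (auto simp: drop_coord_def)

lemma rest_drop: "rest k (drop_coord l k x) = rest k x"
  unfolding rest_def drop_coord_def by (intro sum.cong) auto

lemma tot_rest: "k \<in> L \<Longrightarrow> tot x = d (x k) + rest k x"
  unfolding tot_def rest_def by (intro sum.remove) auto

lemma ins_drop: "k \<in> L \<Longrightarrow> x \<in> P \<Longrightarrow> ins k (drop_coord l k x) (tot x) = x"
  unfolding ins_def rest_drop tot_rest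
  by (rule ext) (auto simp: drop_coord_def PiE_iff extensional_def restrict_def)

lemma ins_inject: "k \<in> L \<Longrightarrow> ins k z g = ins k z g' \<longleftrightarrow> g = g'"
  using tot_ins by metis

lemma line_mem: "k \<in> L \<Longrightarrow> line k z \<in> lines"
  by (auto simp: line_def lines_def)

text \<open>The integer exponent splits into a part fixed along the line and a part from the
  parameter. So along each line \<open>\<Phi>\<close> is one component of \<open>\<Gamma>\<close>
  followed by a fixed measure-preserving map.\<close>

lemma Phi_ins:
  assumes "k \<in> L"
  shows "\<Phi> (ins k z g) = act (line_shift k z) (\<Gamma> g (line k z))"
proof -
  have "\<Psi> (\<lambda>i. fst (d (ins k z g i))) =
    \<Psi> ((\<lambda>i\<in>L - {k}. fst (d (z i)))(k := fst g - (\<Sum>i\<in>L - {k}. (\<lambda>i\<in>L - {k}. fst (d (z i))) i)))"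
    by (rule Psi_cong) (auto simp: ins_def rest_def fst_sum)
  moreover have "(\<lambda>i. if i \<in> L then snd (d (ins k z g i)) else 0) =
    (\<lambda>i. line_shift k z i + unit_vec k (snd g) i)"
    using assms by (auto simp: fun_eq_iff ins_def line_shift_def unit_vec_def)
  ultimately show ?thesis
    using line_mem[OF assms, of z] unfolding \<Phi>_def line_def by (simp add: Gamma_apply act_add)
qed

section \<open>Exceptional sets of lines\<close>

text \<open>For \<open>l = 1\<close> there is only one line, so no exceptional lines can be allowed.\<close>

definition small :: "(nat \<Rightarrow> 'x) set \<Rightarrow> bool" where
  "small K \<longleftrightarrow> countable K \<and> (l = 1 \<longrightarrow> K = {})"

lemma small_empty: "small {}"
  by (simp add: small_def)

lemma small_Un: "small K \<Longrightarrow> small K' \<Longrightarrow> small (K \<union> K')"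
  by (auto simp: small_def)

lemma small_UN: "(\<And>i::nat. small (K i)) \<Longrightarrow> small (\<Union>i. K i)"
  by (auto simp: small_def)

lemma small_image: "small K \<Longrightarrow> small (h ` K)"
  by (auto simp: small_def)

text \<open>For \<open>l = 1\<close> small sets are empty; otherwise a free real coordinate already
  gives uncountably many lines.\<close>

lemma not_small_Z:
  assumes "k \<in> L" "small K"
  shows "\<exists>z\<in>Z k. z \<notin> K"
proof (cases "l = 1")
  case True
  then have "K = {}" using assms unfolding small_def by simp
  moreover have "(\<lambda>i\<in>L - {k}. e 0) \<in> Z k" by auto
  ultimately show ?thesis by blast
next
  case False
  then obtain i where i: "i \<in> L - {k}" using assms l_pos
    by (cases "k = 1") (auto intro: that[of 1] that[of 2])
  let ?h = "\<lambda>r. \<lambda>j\<in>L - {k}. e (r, 0)"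
  show ?thesis
  proof (rule ccontr)
    assume "\<not> ?thesis"
    then have "Z k \<subseteq> K" by blast
    moreover have "range ?h \<subseteq> Z k" by (intro image_subsetI) (simp add: restrict_PiE_iff)
    ultimately have "range ?h \<subseteq> K" by blast
    moreover have "countable K" using assms(2) by (simp add: small_def)
    ultimately have "countable (range ?h)" by (rule countable_subset)
    moreover have "inj ?h"
    proof (rule injI)
      fix r r' assume "?h r = ?h r'"
      from fun_cong[OF this, of i] show "r = r'" using i inj_e by (auto dest: injD)
    qed
    ultimately have "countable (UNIV :: real set)" by (rule countable_image_inj_on)
    then show False using uncountable_UNIV_real by simp
  qed
qed

text \<open>What \<open>line\<close> forgets are the integer parts of finitely many fixed
  coordinates, which leaves countably many possibilities.\<close>

lemma countable_lines_over:
  assumes "countable K"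
  shows "countable {z \<in> Z k. line k z \<in> K}"
proof -
  let ?F = "PiE (L - {k}) (\<lambda>_. UNIV :: int set)"
  have "{z \<in> Z k. line k z \<in> K} \<subseteq> (\<lambda>(j, m). \<lambda>i\<in>L - {k}. e (snd j i, m i)) ` (K \<times> ?F)"
  proof
    fix z assume z: "z \<in> {z \<in> Z k. line k z \<in> K}"
    have "z = (\<lambda>i\<in>L - {k}. e (snd (line k z) i, (\<lambda>i\<in>L - {k}. snd (d (z i))) i))"
      using z by (intro PiE_ext[of z "L - {k}" "\<lambda>_. X"]) (auto simp: line_def PiE_iff)
    then show "z \<in> (\<lambda>(j, m). \<lambda>i\<in>L - {k}. e (snd j i, m i)) ` (K \<times> ?F)"
      using z by (intro image_eqI[of _ _ "(line k z, \<lambda>i\<in>L - {k}. snd (d (z i)))"]) auto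
  qed
  moreover have "countable (K \<times> ?F)"
    using assms by (intro countable_SIGMA countable_PiE) auto
  ultimately show ?thesis by (meson countable_image countable_subset)
qed

text \<open>The first family makes \<open>\<Phi>\<close> and \<open>tot\<close> measurable. The
  second makes the fibres of \<open>drop_coord\<close> measurable, together with countable unions of
  them.\<close>

definition gens :: "(nat \<Rightarrow> 'x) set set" where
  "gens = {\<Phi> -` D \<inter> tot -` E \<inter> P | D E. D \<in> sets \<nu> \<and> E \<in> sets \<Lambda>} \<union>
    {ins k z ` E | k z E. k \<in> L \<and> z \<in> Z k \<and> E \<in> sets \<Lambda>}"

text \<open>The value \<open>a\<close> is common to all directions. Exceptions are allowed for the
  value only, never for the measurability of a section, because \<open>\<Lambda>\<close> is to be
  carried to every line by \<open>ins k z\<close>.\<close>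

definition const_sections :: "(nat \<Rightarrow> 'x) set \<Rightarrow> ennreal \<Rightarrow> bool" where
  "const_sections A a \<longleftrightarrow> A \<subseteq> P \<and>
     (\<forall>k\<in>L. \<forall>z\<in>Z k. ins k z -` A \<in> sets \<Lambda>) \<and>
     (\<forall>k\<in>L. \<exists>K. small K \<and> (\<forall>z\<in>Z k - K. emeasure \<Lambda> (ins k z -` A) = a))"

definition M :: "(nat \<Rightarrow> 'x) measure" where
  "M = measure_of P gens (\<lambda>A. THE a. const_sections A a)"

section \<open>Sections of the generators\<close>

lemma countable_sets_Lambda: "countable A \<Longrightarrow> A \<in> sets \<Lambda>"
  using countable_null by auto

lemma gens_sub: "gens \<subseteq> Pow P"
proof -
  have "ins k z ` E \<subseteq> P" if "k \<in> L" "z \<in> Z k" for k z E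
    using ins_mem[OF that] by blast
  then show ?thesis unfolding gens_def by blast
qed

lemma ins_image_eq:
  assumes "k \<in> L" "z \<in> Z k"
  shows "ins k z ` E = {x \<in> P. drop_coord l k x = z \<and> tot x \<in> E}"
proof (intro equalityI subsetI)
  fix x assume "x \<in> ins k z ` E"
  then obtain g where "x = ins k z g" "g \<in> E" by (elim imageE)
  then show "x \<in> {x \<in> P. drop_coord l k x = z \<and> tot x \<in> E}"
    using ins_mem[OF assms] drop_ins[OF assms] tot_ins[OF assms(1)] by (simp only: mem_Collect_eq simp_thms)
next
  fix x assume "x \<in> {x \<in> P. drop_coord l k x = z \<and> tot x \<in> E}"
  then have "x = ins k z (tot x)" "tot x \<in> E" using ins_drop[OF assms(1)] by auto
  then show "x \<in> ins k z ` E" by (rule image_eqI)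
qed

text \<open>Every coordinate survives in at least one of the two projections; hence lines of
  different directions share at most one point.\<close>

lemma drop_eqI:
  assumes "k \<noteq> k'" "k \<in> L" "k' \<in> L" "x \<in> P" "y \<in> P"
    and "drop_coord l k x = drop_coord l k y" "drop_coord l k' x = drop_coord l k' y"
  shows "x = y"
proof (rule PiE_ext[OF assms(4,5)])
  fix i assume "i \<in> L"
  then show "x i = y i"
    using fun_cong[OF assms(6), of i] fun_cong[OF assms(7), of i] assms(1) unfolding drop_coord_def
    by (cases "i = k") auto
qed

lemma gens_box: "D \<in> sets \<nu> \<Longrightarrow> E \<in> sets \<Lambda> \<Longrightarrow> \<Phi> -` D \<inter> tot -` E \<inter> P \<in> gens"
  unfolding gens_def by blast

lemma gens_line: "k \<in> L \<Longrightarrow> z \<in> Z k \<Longrightarrow> E \<in> sets \<Lambda> \<Longrightarrow> ins k z ` E \<in> gens"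
  unfolding gens_def by blast

lemma gensE:
  assumes "A \<in> gens"
  obtains D E where "A = \<Phi> -` D \<inter> tot -` E \<inter> P" "D \<in> sets \<nu>" "E \<in> sets \<Lambda>"
  | k z E where "A = ins k z ` E" "k \<in> L" "z \<in> Z k" "E \<in> sets \<Lambda>"
  using assms unfolding gens_def by blast

lemma section_box:
  assumes "k \<in> L" "z \<in> Z k"
  shows "ins k z -` (\<Phi> -` D \<inter> tot -` E \<inter> P) =
    E \<inter> {g. \<Gamma> g (line k z) \<in> act (line_shift k z) -` D}"
  using ins_mem[OF assms] by (auto simp only: vimage_Int tot_ins[OF assms(1)] Phi_ins[OF assms(1)] vimage_eq
      Int_iff mem_Collect_eq)

lemma section_box_measurable:
  assumes "k \<in> L" "z \<in> Z k" "D \<in> sets \<nu>" "E \<in> sets \<Lambda>"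
  shows "ins k z -` (\<Phi> -` D \<inter> tot -` E \<inter> P) \<in> sets \<Lambda>"
proof -
  from measurable_sets[OF Gamma_component_measurable[OF line_mem[OF assms(1)]] act_vimage[OF assms(3)]]
  have "{g. \<Gamma> g (line k z) \<in> act (line_shift k z) -` D} \<in> sets \<Lambda>"
    by (simp add: space_pullback vimage_def)
  then show ?thesis unfolding section_box[OF assms(1,2)] using assms(4) by (rule sets.Int[rotated])
qed

lemma section_line_same: "k \<in> L \<Longrightarrow> ins k z -` (ins k z ` E) = E"
  by (intro inj_vimage_image_eq injI) (simp add: ins_inject)

lemma section_line_disjoint:
  assumes "k \<in> L" "z \<in> Z k" "z' \<in> Z k" "z \<noteq> z'"
  shows "ins k z -` (ins k z' ` E) = {}"
proof -
  have "ins k z g \<noteq> ins k z' g'" for g g'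
    using drop_ins[OF assms(1,2), of g] drop_ins[OF assms(1,3), of g'] assms(4) by auto
  then show ?thesis by blast
qed

lemma section_line_countable:
  assumes "k \<in> L" "z \<in> Z k" "k' \<in> L" "z' \<in> Z k'" "k \<noteq> k'"
  shows "countable (ins k z -` (ins k' z' ` E))"
proof -
  have "g = g'" if "ins k z g \<in> ins k' z' ` E" "ins k z g' \<in> ins k' z' ` E" for g g'
  proof -
    have "drop_coord l k' (ins k z g) = z'" "drop_coord l k' (ins k z g') = z'"
      using that drop_ins[OF assms(3,4)] by (metis imageE)+
    then have "ins k z g = ins k z g'"
      by (intro drop_eqI[OF assms(5,1,3) ins_mem[OF assms(1,2)] ins_mem[OF assms(1,2)]])
        (simp_all only: drop_ins[OF assms(1,2)])
    then show ?thesis by (simp only: ins_inject[OF assms(1)])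
  qed
  then have "ins k z -` (ins k' z' ` E) = {} \<or> (\<exists>g. ins k z -` (ins k' z' ` E) = {g})" by blast
  then show ?thesis by (elim disjE exE) (simp_all only: countable_empty countable_insert)
qed

lemma section_line_measurable:
  assumes "k \<in> L" "z \<in> Z k" "k' \<in> L" "z' \<in> Z k'" "E \<in> sets \<Lambda>"
  shows "ins k z -` (ins k' z' ` E) \<in> sets \<Lambda>"
proof (cases "k = k'")
  case True
  show ?thesis
  proof (cases "z = z'")
    case True
    then show ?thesis using \<open>k = k'\<close> section_line_same[OF assms(3)] assms(5) by simp
  next
    case False
    then show ?thesis using \<open>k = k'\<close> section_line_disjoint assms by simp
  qed
next
  case False
  then show ?thesis using section_line_countable[OF assms(1-4)] countable_sets_Lambda by blast
qed

lemma section_gens_measurable: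
  assumes "A \<in> gens" "k \<in> L" "z \<in> Z k"
  shows "ins k z -` A \<in> sets \<Lambda>"
proof (rule gensE[OF assms(1)])
  fix D E assume "A = \<Phi> -` D \<inter> tot -` E \<inter> P" "D \<in> sets \<nu>" "E \<in> sets \<Lambda>"
  then show ?thesis using section_box_measurable[OF assms(2,3)] by blast
next
  fix k' z' E assume "A = ins k' z' ` E" "k' \<in> L" "z' \<in> Z k'" "E \<in> sets \<Lambda>"
  then show ?thesis using section_line_measurable[OF assms(2,3)] by blast
qed

text \<open>Boxes intersect in boxes. A generator cut with a piece of a line is again a piece of
  that line, measurable because all sections of generators are.\<close>

lemma Int_stable_gens: "Int_stable gens"
proof (rule Int_stableI)
  fix a b assume a: "a \<in> gens" and b: "b \<in> gens"
  have line: "A \<inter> ins k z ` E \<in> gens"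
    if A: "A \<in> gens" and k: "k \<in> L" "z \<in> Z k" "E \<in> sets \<Lambda>" for A k z E
  proof -
    have "ins k z -` A \<in> sets \<Lambda>"
      by (rule section_gens_measurable[OF A k(1,2)])
    moreover have "A \<inter> ins k z ` E = ins k z ` (ins k z -` A \<inter> E)" by blast
    ultimately show ?thesis using gens_line[OF k(1,2)] k(3) by simp
  qed
  show "a \<inter> b \<in> gens"
  proof (rule gensE[OF b])
    fix k z E assume "b = ins k z ` E" "k \<in> L" "z \<in> Z k" "E \<in> sets \<Lambda>"
    then show ?thesis using line[OF a] by simp
  next
    fix D E assume b': "b = \<Phi> -` D \<inter> tot -` E \<inter> P" "D \<in> sets \<nu>" "E \<in> sets \<Lambda>"
    show ?thesis
    proof (rule gensE[OF a])
      fix k z E assume "a = ins k z ` E" "k \<in> L" "z \<in> Z k" "E \<in> sets \<Lambda>"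
      then show ?thesis using line[OF b, of k z E] by (simp only: Int_commute)
    next
      fix D' E' assume a': "a = \<Phi> -` D' \<inter> tot -` E' \<inter> P" "D' \<in> sets \<nu>" "E' \<in> sets \<Lambda>"
      have "a \<inter> b = \<Phi> -` (D' \<inter> D) \<inter> tot -` (E' \<inter> E) \<inter> P" unfolding a' b' by blast
      then show ?thesis using gens_box[of "D' \<inter> D" "E' \<inter> E"] a' b' by simp
    qed
  qed
qed

section \<open>Sets with almost constant section measure\<close>

lemma const_sectionsI:
  assumes "A \<subseteq> P" "\<And>k z. k \<in> L \<Longrightarrow> z \<in> Z k \<Longrightarrow> ins k z -` A \<in> sets \<Lambda>"
    and "\<And>k. k \<in> L \<Longrightarrow> \<exists>K. small K \<and> (\<forall>z\<in>Z k - K. emeasure \<Lambda> (ins k z -` A) = a)"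
  shows "const_sections A a"
  using assms unfolding const_sections_def by blast

lemma const_sectionsD:
  assumes "const_sections A a"
  shows "A \<subseteq> P" "\<And>k z. k \<in> L \<Longrightarrow> z \<in> Z k \<Longrightarrow> ins k z -` A \<in> sets \<Lambda>"
    "\<And>k. k \<in> L \<Longrightarrow> \<exists>K. small K \<and> (\<forall>z\<in>Z k - K. emeasure \<Lambda> (ins k z -` A) = a)"
  using assms unfolding const_sections_def by simp_all

text \<open>The two values are compared on a line that is exceptional for neither.\<close>

lemma const_sections_unique:
  assumes "const_sections A a" "const_sections A b"
  shows "a = b"
proof -
  have k: "1 \<in> L" using l_pos by simp
  obtain K where K: "small K" "\<forall>z\<in>Z 1 - K. emeasure \<Lambda> (ins 1 z -` A) = a"
    using const_sectionsD(3)[OF assms(1) k] by (elim exE conjE)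
  obtain K' where K': "small K'" "\<forall>z\<in>Z 1 - K'. emeasure \<Lambda> (ins 1 z -` A) = b"
    using const_sectionsD(3)[OF assms(2) k] by (elim exE conjE)
  obtain z where "z \<in> Z 1" "z \<notin> K \<union> K'" using not_small_Z[OF k small_Un[OF K(1) K'(1)]] by blast
  then have "emeasure \<Lambda> (ins 1 z -` A) = a" "emeasure \<Lambda> (ins 1 z -` A) = b" using K(2) K'(2) by blast+
  then show ?thesis by simp
qed

text \<open>The whole space is then a single line, the one over the empty tuple
  \<open>\<lambda>_. undefined\<close>, and its section measure is trivially constant.\<close>

lemma const_sections_dim1:
  assumes "l = 1" "A \<subseteq> P" "\<And>k z. k \<in> L \<Longrightarrow> z \<in> Z k \<Longrightarrow> ins k z -` A \<in> sets \<Lambda>"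
  shows "const_sections A (emeasure \<Lambda> (ins 1 (\<lambda>_. undefined) -` A))"
proof (rule const_sectionsI[OF assms(2,3)])
  fix k assume "k \<in> L"
  then have "k = 1" using assms(1) by simp
  moreover from this have "L - {k} = {}" using assms(1) by simp
  then have "Z k = {\<lambda>_. undefined}" by (simp only: PiE_empty_domain)
  ultimately show "\<exists>K. small K \<and> (\<forall>z\<in>Z k - K. emeasure \<Lambda> (ins k z -` A) =
      emeasure \<Lambda> (ins 1 (\<lambda>_. undefined) -` A))"
    by (intro exI[of _ "{}"] conjI small_empty) simp
qed

text \<open>Outside countably many lines the value of \<open>\<Phi>\<close> is independent of the
  event that the sum lies in \<open>E\<close>. The translation by \<open>line_shift\<close> depends
  on the line but does not change the probability of \<open>D\<close>.\<close>

lemma const_sections_box: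
  assumes "D \<in> sets \<nu>" "E \<in> sets \<Lambda>" "l \<noteq> 1"
  shows "const_sections (\<Phi> -` D \<inter> tot -` E \<inter> P) (emeasure \<Lambda> E * emeasure \<nu> D)"
proof (rule const_sectionsI)
  obtain K where K: "countable K" "\<forall>j\<in>lines - K. \<forall>D\<in>sets \<nu>.
      emeasure \<Lambda> (E \<inter> {g. \<Gamma> g j \<in> D}) = emeasure \<Lambda> E * emeasure \<nu> D"
    using Lambda_independent_line[OF assms(2)] by (elim exE conjE)
  fix k assume k: "k \<in> L"
  have "emeasure \<Lambda> (ins k z -` (\<Phi> -` D \<inter> tot -` E \<inter> P)) = emeasure \<Lambda> E * emeasure \<nu> D"
    if z: "z \<in> Z k" "line k z \<notin> K" for z
  proof -
    have "line k z \<in> lines - K" using z line_mem[OF k] by simp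
    then show ?thesis
      using K(2) act_vimage[OF assms(1)] emeasure_act[OF assms(1)] unfolding section_box[OF k z(1)] by metis
  qed
  moreover have "small {z \<in> Z k. line k z \<in> K}"
    using countable_lines_over[OF K(1)] assms(3) by (simp add: small_def)
  ultimately show "\<exists>K. small K \<and> (\<forall>z\<in>Z k - K.
      emeasure \<Lambda> (ins k z -` (\<Phi> -` D \<inter> tot -` E \<inter> P)) = emeasure \<Lambda> E * emeasure \<nu> D)"
    by blast
next
  show "ins k z -` (\<Phi> -` D \<inter> tot -` E \<inter> P) \<in> sets \<Lambda>" if "k \<in> L" "z \<in> Z k" for k z
    using section_box_measurable[OF that assms(1,2)] .
qed blast

text \<open>Lines of the same direction are equal or disjoint, and a line of another direction meets
  this one in at most one point, which is null. Only \<open>z\<close> itself has to be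
  excepted.\<close>

lemma const_sections_line:
  assumes "k \<in> L" "z \<in> Z k" "E \<in> sets \<Lambda>" "l \<noteq> 1"
  shows "const_sections (ins k z ` E) 0"
proof (rule const_sectionsI)
  fix k' assume k': "k' \<in> L"
  have "emeasure \<Lambda> (ins k' z' -` (ins k z ` E)) = 0" if z': "z' \<in> Z k'" "z' \<noteq> z" for z'
  proof (cases "k' = k")
    case True
    then show ?thesis using section_line_disjoint[OF assms(1), of z' z E] z' assms by simp
  next
    case False
    then show ?thesis using countable_null[OF section_line_countable[OF k' z'(1) assms(1,2)]] by auto
  qed
  moreover have "small {z}" using assms(4) by (simp add: small_def)
  ultimately show "\<exists>K. small K \<and> (\<forall>z'\<in>Z k' - K. emeasure \<Lambda> (ins k' z' -` (ins k z ` E)) = 0)"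
    by blast
next
  show "ins k' z' -` (ins k z ` E) \<in> sets \<Lambda>" if "k' \<in> L" "z' \<in> Z k'" for k' z'
    using section_line_measurable[OF that assms(1-3)] .
  show "ins k z ` E \<subseteq> P" using ins_mem[OF assms(1,2)] by blast
qed

lemma const_sections_gens:
  assumes "A \<in> gens"
  shows "\<exists>a. const_sections A a"
proof (cases "l = 1")
  case True
  show ?thesis
  proof (rule exI, rule const_sections_dim1[OF True])
    show "A \<subseteq> P" using assms gens_sub by blast
  qed (rule section_gens_measurable[OF assms])
next
  case False
  show ?thesis
  proof (rule gensE[OF assms])
    fix D E assume "A = \<Phi> -` D \<inter> tot -` E \<inter> P" "D \<in> sets \<nu>" "E \<in> sets \<Lambda>"
    then show ?thesis using const_sections_box[OF _ _ False] by blast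
  next
    fix k z E assume "A = ins k z ` E" "k \<in> L" "z \<in> Z k" "E \<in> sets \<Lambda>"
    then show ?thesis using const_sections_line[OF _ _ _ False] by blast
  qed
qed

lemma const_sections_UN:
  assumes "disjoint_family A" "\<And>i::nat. const_sections (A i) (a i)"
  shows "const_sections (\<Union>i. A i) (\<Sum>i. a i)"
proof (rule const_sectionsI)
  show "(\<Union>i. A i) \<subseteq> P" using const_sectionsD(1)[OF assms(2)] by (rule UN_least)
  note s = const_sectionsD(2)[OF assms(2)]
  show "ins k z -` (\<Union>i. A i) \<in> sets \<Lambda>" if "k \<in> L" "z \<in> Z k" for k z
    unfolding vimage_UN using s[OF that] by (intro sets.countable_UN) auto
  fix k assume k: "k \<in> L"
  have "\<forall>i. \<exists>K. small K \<and> (\<forall>z\<in>Z k - K. emeasure \<Lambda> (ins k z -` A i) = a i)"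
    using const_sectionsD(3)[OF assms(2) k] by (rule allI)
  from choice[OF this] obtain K where
    K: "\<And>i. small (K i)" "\<And>i. \<forall>z\<in>Z k - K i. emeasure \<Lambda> (ins k z -` A i) = a i"
    by (elim exE) blast
  have "emeasure \<Lambda> (ins k z -` (\<Union>i. A i)) = (\<Sum>i. a i)" if z: "z \<in> Z k - (\<Union>i. K i)" for z
  proof -
    have "(\<Sum>i. emeasure \<Lambda> (ins k z -` A i)) = emeasure \<Lambda> (\<Union>i. ins k z -` A i)"
      using assms(1) s k z by (intro suminf_emeasure) (auto simp: disjoint_family_on_def)
    moreover have "emeasure \<Lambda> (ins k z -` A i) = a i" for i using K(2)[of i] z by blast
    ultimately show ?thesis by (simp add: vimage_UN)
  qed
  then show "\<exists>K. small K \<and> (\<forall>z\<in>Z k - K. emeasure \<Lambda> (ins k z -` (\<Union>i. A i)) = (\<Sum>i. a i))"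
    using small_UN[of K] K(1) by blast
qed

lemma const_sections_compl:
  assumes "const_sections A a"
  shows "const_sections (P - A) (1 - a)"
proof (rule const_sectionsI)
  note s = const_sectionsD(2)[OF assms]
  have eq: "ins k z -` (P - A) = space \<Lambda> - ins k z -` A" if "k \<in> L" "z \<in> Z k" for k z
    using ins_mem[OF that] unfolding space_pullback by blast
  show "ins k z -` (P - A) \<in> sets \<Lambda>" if "k \<in> L" "z \<in> Z k" for k z
    unfolding eq[OF that] using s[OF that] by (rule sets.compl_sets)
  fix k assume k: "k \<in> L"
  obtain K where K: "small K" "\<forall>z\<in>Z k - K. emeasure \<Lambda> (ins k z -` A) = a"
    using const_sectionsD(3)[OF assms k] by (elim exE conjE)
  have "emeasure \<Lambda> (ins k z -` (P - A)) = 1 - a" if z: "z \<in> Z k - K" for z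
  proof -
    interpret prob_space \<Lambda> by (rule prob_Lambda)
    have z': "z \<in> Z k" using z by blast
    have "emeasure \<Lambda> (space \<Lambda> - ins k z -` A) = emeasure \<Lambda> (space \<Lambda>) - emeasure \<Lambda> (ins k z -` A)"
      using s[OF k z'] by (intro emeasure_compl) auto
    then show ?thesis using K(2) z unfolding eq[OF k z'] emeasure_space_1 by simp
  qed
  then show "\<exists>K. small K \<and> (\<forall>z\<in>Z k - K. emeasure \<Lambda> (ins k z -` (P - A)) = 1 - a)"
    using K(1) by blast
qed auto

text \<open>The constants of two sets do not determine that of their intersection, so the induction
  runs over complements and disjoint unions, starting from the intersection-stable
  generators.\<close>

lemma const_sections_sigma:
  assumes "A \<in> sigma_sets P gens"
  shows "\<exists>a. const_sections A a"
  using assms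
proof (induction rule: sigma_sets_induct_disjoint[OF Int_stable_gens gens_sub, consumes 1,
    case_names basic empty compl union])
  case (basic A)
  then show ?case by (rule const_sections_gens)
next
  case empty
  have "const_sections {} 0" by (rule const_sectionsI) (auto intro: small_empty)
  then show ?case by blast
next
  case (compl A)
  then show ?case using const_sections_compl by blast
next
  case (union A)
  then obtain a where "\<And>i. const_sections (A i) (a i)" by metis
  then show ?case using const_sections_UN[OF union(1)] by blast
qed

lemma space_M: "space M = P"
  unfolding M_def using gens_sub by (rule space_measure_of)

lemma sets_M: "sets M = sigma_sets P gens"
  unfolding M_def using gens_sub by (rule sets_measure_of)

text \<open>Uniqueness of the constant turns closure under disjoint unions into countable
  additivity, so the values picked by \<open>THE\<close> do form a measure.\<close>

lemma const_sections_emeasure: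
  assumes "A \<in> sets M"
  shows "const_sections A (emeasure M A)"
proof -
  let ?\<mu> = "\<lambda>A. THE a. const_sections A a"
  have val: "?\<mu> A = a" if "const_sections A a" for A a
    using that const_sections_unique by blast
  have ex: "const_sections A (?\<mu> A)" if "A \<in> sets M" for A
    using const_sections_sigma that val unfolding sets_M by metis
  have "emeasure M A = ?\<mu> A"
  proof (rule emeasure_measure_of[OF M_def gens_sub _ _ assms])
    have "const_sections {} 0" by (rule const_sectionsI) (auto intro: small_empty)
    then show "positive (sets M) ?\<mu>" unfolding positive_def by (rule val)
    show "countably_additive (sets M) ?\<mu>"
    proof (rule countably_additiveI)
      fix A :: "nat \<Rightarrow> _" assume "range A \<subseteq> sets M" "disjoint_family A"
      then have "const_sections (\<Union>i. A i) (\<Sum>i. ?\<mu> (A i))"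
        using ex by (intro const_sections_UN) auto
      then show "(\<Sum>i. ?\<mu> (A i)) = ?\<mu> (\<Union>i. A i)" using val by simp
    qed
  qed
  then show ?thesis using ex[OF assms] by simp
qed

end

section \<open>Criteria for isomorphisms and for the lattice action\<close>

lemma measure_isoI:
  assumes h: "h \<in> M \<rightarrow>\<^sub>M N" and h': "h' \<in> N \<rightarrow>\<^sub>M M"
    and inv: "\<And>x. x \<in> space M \<Longrightarrow> h' (h x) = x" "\<And>y. y \<in> space N \<Longrightarrow> h (h' y) = y"
    and d: "distr M N h = N"
  shows "measure_iso M N h"
proof -
  have bij: "bij_betw h (space M) (space N)"
    by (rule bij_betw_byWitness[of _ h']) (use inv measurable_space[OF h] measurable_space[OF h'] in auto)
  have "inv_into (space M) h y = h' y" if "y \<in> space N" for y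
    using that inv measurable_space[OF h'] bij by (intro inv_into_f_eq) (auto simp: bij_betw_def)
  then have "inv_into (space M) h \<in> N \<rightarrow>\<^sub>M M"
    using h' by (simp cong: measurable_cong)
  then show ?thesis using bij h d unfolding measure_iso_def by blast
qed

text \<open>When each transformation is a unit translation of an action \<open>H\<close>, its
  inverse is the opposite translation; powers and their composites then follow from the group law.
  Used for the cube and for its coordinate factors.\<close>

lemma group_act_eq:
  assumes H: "\<And>x. x \<in> S \<Longrightarrow> H (\<lambda>_. 0) x = x" "\<And>m m' x. x \<in> S \<Longrightarrow> H m (H m' x) = H (\<lambda>i. m i + m' i) x"
      "\<And>m x. x \<in> S \<Longrightarrow> H m x \<in> S"
    and T: "\<And>i x. i \<in> {1..l} \<Longrightarrow> x \<in> S \<Longrightarrow> T i x = H (unit_vec i 1) x"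
    and S: "space M = S" and x: "x \<in> S"
  shows "group_act M T l g x = H (\<lambda>i. if i \<in> {1..l} then g i else 0) x"
proof -
  have H_unit: "H (unit_vec i m) (H (unit_vec i n) x) = H (unit_vec i (m + n)) x" if "x \<in> S" for i m n x
    using that by (simp add: H(2)) (auto simp: unit_vec_def intro!: arg_cong[of _ _ "\<lambda>m. H m x"])
  have unit0: "unit_vec i 0 = (\<lambda>_. 0)" for i by (auto simp: unit_vec_def)
  have inv: "inv_into S (T i) x = H (unit_vec i (-1)) x" if i: "i \<in> {1..l}" and x: "x \<in> S" for i x
  proof (rule inv_into_f_eq)
    show "inj_on (T i) S"
      by (rule inj_on_inverseI[of _ "H (unit_vec i (-1))"]) (use i in \<open>simp add: T H_unit unit0 H(1)\<close>)
    show "T i (H (unit_vec i (- 1)) x) = x" using i x by (simp add: T H(3) H_unit unit0 H(1))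
  qed (use x H(3) in auto)
  have pos: "(T i ^^ n) x = H (unit_vec i (int n)) x" if i: "i \<in> {1..l}" and x: "x \<in> S" for i x n
    by (induction n) (use i x in \<open>simp_all add: T H(3) H_unit unit0 H(1) add.commute\<close>)
  have neg: "(inv_into S (T i) ^^ n) x = H (unit_vec i (- int n)) x" if i: "i \<in> {1..l}" and x: "x \<in> S" for i x n
    by (induction n) (use i x in \<open>simp_all add: inv H(3) H_unit unit0 H(1) add.commute\<close>)
  have iter: "int_iterate M (T i) n x = H (unit_vec i n) x" if i: "i \<in> {1..l}" and x: "x \<in> S" for i x n
    using pos[OF i x, of "nat n"] neg[OF i x, of "nat (- n)"] by (simp add: int_iterate_def S)
  have "group_act M T l' g x = H (\<lambda>i. if i \<in> {1..l'} then g i else 0) x" if "l' \<le> l" for l'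
    using that
  proof (induction l')
    case 0
    show ?case using H(1)[OF x] by simp
  next
    case (Suc l')
    have "(\<lambda>i. unit_vec (Suc l') (g (Suc l')) i + (if i \<in> {1..l'} then g i else 0)) =
      (\<lambda>i. if i \<in> {1..Suc l'} then g i else 0)"
      by (auto simp: unit_vec_def fun_eq_iff)
    moreover have "Suc l' \<in> {1..l}" using Suc.prems by simp
    ultimately show ?case using Suc x iter[OF _ H(3)[OF x]] H(2)[OF x] by simp
  qed
  then show ?thesis by simp
qed

context generic_cube begin

section \<open>Laws of \<open>\<Phi>\<close> and \<open>tot\<close>, and invariance under
  translations\<close>

lemma emeasure_M_eqI: "A \<in> sets M \<Longrightarrow> const_sections A a \<Longrightarrow> emeasure M A = a"
  using const_sections_unique const_sections_emeasure by blast

lemma ins_measurable: "k \<in> L \<Longrightarrow> z \<in> Z k \<Longrightarrow> ins k z \<in> \<Lambda> \<rightarrow>\<^sub>M M"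
proof (rule measurableI)
  fix A assume "k \<in> L" "z \<in> Z k" "A \<in> sets M"
  then show "ins k z -` A \<inter> space \<Lambda> \<in> sets \<Lambda>"
    using const_sectionsD(2)[OF const_sections_emeasure] by (simp add: space_pullback)
qed (simp add: ins_mem space_M)

lemma prob_M: "prob_space M"
proof
  have "ins k z -` P = space \<Lambda>" if "k \<in> L" "z \<in> Z k" for k z
    using ins_mem[OF that] unfolding space_pullback by blast
  then have "const_sections P 1"
    using prob_space.emeasure_space_1[OF prob_Lambda]
    by (intro const_sectionsI exI[of _ "{}"]) (auto simp: small_empty)
  then show "emeasure M (space M) = 1"
    using emeasure_M_eqI[OF sets.top] unfolding space_M by blast
qed

lemma gens_sets: "A \<in> gens \<Longrightarrow> A \<in> sets M"
  unfolding sets_M by (rule sigma_sets.Basic)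

lemma Phi_measurable: "\<Phi> \<in> M \<rightarrow>\<^sub>M \<nu>"
proof (rule measurableI)
  fix D assume "D \<in> sets \<nu>"
  from gens_sets[OF gens_box[OF this, of UNIV]] show "\<Phi> -` D \<inter> space M \<in> sets M"
    using sets.top[of \<Lambda>] by (simp add: space_pullback space_M)
qed (simp add: space_nu)

lemma tot_measurable: "tot \<in> M \<rightarrow>\<^sub>M \<Lambda>"
proof (rule measurableI)
  fix E assume "E \<in> sets \<Lambda>"
  from gens_sets[OF gens_box[OF sets.top this]] show "tot -` E \<inter> space M \<in> sets M"
    by (simp add: space_nu space_M)
qed (simp add: space_pullback)

lemma UNIV_Lambda: "UNIV \<in> sets \<Lambda>"
  using sets.top[of \<Lambda>] by (simp add: space_pullback)

text \<open>Along every line \<open>\<Phi>\<close> has law \<nu>, since each component of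
  \<open>\<Gamma>\<close> has and translations preserve it. No line is exceptional, which covers
  \<open>l = 1\<close> as well.\<close>

lemma distr_Phi: "distr M \<nu> \<Phi> = \<nu>"
proof (rule measure_eqI)
  fix D assume "D \<in> sets (distr M \<nu> \<Phi>)"
  then have D: "D \<in> sets \<nu>" by simp
  have box: "\<Phi> -` D \<inter> P = \<Phi> -` D \<inter> tot -` UNIV \<inter> P" by simp
  have "ins k z -` (\<Phi> -` D \<inter> P) \<in> sets \<Lambda>" if "k \<in> L" "z \<in> Z k" for k z
    unfolding box by (rule section_box_measurable[OF that D UNIV_Lambda])
  moreover have "emeasure \<Lambda> (ins k z -` (\<Phi> -` D \<inter> P)) = emeasure \<nu> D" if "k \<in> L" "z \<in> Z k" for k z
    unfolding box section_box[OF that] Int_UNIV_left emeasure_Gamma_component[OF line_mem[OF that(1)] act_vimage[OF D]]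
    by (rule emeasure_act[OF D])
  ultimately have "const_sections (\<Phi> -` D \<inter> P) (emeasure \<nu> D)"
    unfolding const_sections_def using small_empty by blast
  moreover have "\<Phi> -` D \<inter> P \<in> sets M" using measurable_sets[OF Phi_measurable D] by (simp add: space_M)
  ultimately show "emeasure (distr M \<nu> \<Phi>) D = emeasure \<nu> D"
    using emeasure_M_eqI by (simp add: emeasure_distr[OF Phi_measurable D] space_M)
qed simp

lemma distr_tot: "distr M \<Lambda> tot = \<Lambda>"
proof (rule measure_eqI)
  fix E assume "E \<in> sets (distr M \<Lambda> tot)"
  then have E: "E \<in> sets \<Lambda>" by simp
  have "ins k z -` (tot -` E \<inter> P) = E" if "k \<in> L" "z \<in> Z k" for k z
    using ins_mem[OF that] tot_ins[OF that(1)] by auto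
  then have "const_sections (tot -` E \<inter> P) (emeasure \<Lambda> E)"
    using E by (intro const_sectionsI exI[of _ "{}"]) (auto simp: small_empty)
  moreover have "tot -` E \<inter> P \<in> sets M" using measurable_sets[OF tot_measurable E] by (simp add: space_M)
  ultimately show "emeasure (distr M \<Lambda> tot) E = emeasure \<Lambda> E"
    using emeasure_M_eqI by (simp add: emeasure_distr[OF tot_measurable E] space_M)
qed simp

lemma fibre_eq: "k \<in> L \<Longrightarrow> z \<in> Z k \<Longrightarrow> drop_coord l k -` {z} \<inter> P = ins k z ` UNIV"
  unfolding ins_image_eq by auto

lemma fibre_sets: "k \<in> L \<Longrightarrow> z \<in> Z k \<Longrightarrow> drop_coord l k -` {z} \<inter> P \<in> sets M"
  unfolding fibre_eq by (rule gens_sets, rule gens_line[OF _ _ UNIV_Lambda])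

text \<open>For \<open>l = 1\<close> the only fibre is the whole space, so that case is
  excluded.\<close>

lemma fibre_null: "k \<in> L \<Longrightarrow> z \<in> Z k \<Longrightarrow> l \<noteq> 1 \<Longrightarrow> drop_coord l k -` {z} \<inter> P \<in> null_sets M"
  unfolding null_sets_def
  using fibre_sets emeasure_M_eqI const_sections_line[OF _ _ UNIV_Lambda] by (simp add: fibre_eq)

text \<open>With \<open>A = L\<close> this is the lattice action on the cube, with
  \<open>A = L - {k}\<close> the action it induces on the k-th projection.\<close>

definition sh :: "nat set \<Rightarrow> (nat \<Rightarrow> int) \<Rightarrow> (nat \<Rightarrow> 'x) \<Rightarrow> nat \<Rightarrow> 'x" where
  "sh A m x = (\<lambda>i\<in>A. e (d (x i) + (0, m i)))"

lemma sh_mem: "sh A m x \<in> PiE A (\<lambda>_. X)"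
  by (simp add: sh_def restrict_PiE_iff)

lemma sh_zero: "x \<in> PiE A (\<lambda>_. X) \<Longrightarrow> sh A (\<lambda>_. 0) x = x"
  unfolding sh_def by (rule PiE_ext[of _ A "\<lambda>_. X"]) (auto simp: PiE_mem[of x A "\<lambda>_. X"] simp flip: zero_prod_def)

lemma sh_add: "sh A m (sh A m' x) = sh A (\<lambda>i. m i + m' i) x"
proof
  fix i
  have "d (x i) + (0, m' i) + (0, m i) = d (x i) + (0, m i + m' i)" by (cases "d (x i)") simp
  then show "sh A m (sh A m' x) i = sh A (\<lambda>i. m i + m' i) x i"
    by (simp only: sh_def restrict_apply d_e split: if_split) simp
qed

lemma sh_inverse: "x \<in> PiE A (\<lambda>_. X) \<Longrightarrow> sh A m (sh A (\<lambda>i. - m i) x) = x"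
    "x \<in> PiE A (\<lambda>_. X) \<Longrightarrow> sh A (\<lambda>i. - m i) (sh A m x) = x"
  by (simp_all add: sh_add sh_zero)

lemma drop_sh: "drop_coord l k (sh L m x) = sh (L - {k}) m (drop_coord l k x)"
  unfolding sh_def drop_coord_def by (auto simp: restrict_def fun_eq_iff)

lemma tot_sh: "tot (sh L m x) = tot x + (0, \<Sum>i\<in>L. m i)"
proof -
  have "tot (sh L m x) = (\<Sum>i\<in>L. d (x i) + (0, m i))"
    unfolding tot_def sh_def by (intro sum.cong) simp_all
  also have "\<dots> = tot x + (\<Sum>i\<in>L. (0, m i))" unfolding tot_def by (rule sum.distrib)
  also have "(\<Sum>i\<in>L. (0 :: real, m i)) = (0, \<Sum>i\<in>L. m i)"
    by (rule prod_eqI) (simp_all add: fst_sum snd_sum)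
  finally show ?thesis .
qed

lemma Phi_sh: "\<Phi> (sh L m x) = act (\<lambda>i. if i \<in> L then m i else 0) (\<Phi> x)"
proof -
  have "\<Psi> (\<lambda>i. fst (d (sh L m x i))) = \<Psi> (\<lambda>i. fst (d (x i)))"
    by (rule Psi_cong) (simp add: sh_def)
  moreover have "(\<lambda>i. if i \<in> L then snd (d (sh L m x i)) else 0) =
    (\<lambda>i. (if i \<in> L then m i else 0) + (if i \<in> L then snd (d (x i)) else 0))"
    by (auto simp: sh_def fun_eq_iff)
  ultimately show ?thesis unfolding \<Phi>_def act_add by simp
qed

lemma sh_ins:
  assumes "k \<in> L" "z \<in> Z k"
  shows "sh L m (ins k z g) = ins k (sh (L - {k}) m z) (g + (0, \<Sum>i\<in>L. m i))"
  using ins_drop[OF assms(1) sh_mem, of m "ins k z g"]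
  unfolding drop_sh tot_sh drop_ins[OF assms] tot_ins[OF assms(1)] by simp

lemma sh_measurable: "sh L m \<in> M \<rightarrow>\<^sub>M M"
proof (rule measurable_sigma_sets[OF sets_M gens_sub])
  show "sh L m \<in> space M \<rightarrow> P" using sh_mem by blast
  let ?t = "\<lambda>g :: real \<times> int. g + (0, \<Sum>i\<in>L. m i)"
  have t: "?t -` E \<in> sets \<Lambda>" if "E \<in> sets \<Lambda>" for E
    using measurable_sets[OF Lambda_shift(1) that] by (simp add: space_pullback)
  fix A assume "A \<in> gens"
  then show "sh L m -` A \<inter> space M \<in> sets M"
  proof (rule gensE)
    fix D E assume A: "A = \<Phi> -` D \<inter> tot -` E \<inter> P" and "D \<in> sets \<nu>" "E \<in> sets \<Lambda>"
    then have "\<Phi> -` (act (\<lambda>i. if i \<in> L then m i else 0) -` D) \<inter> tot -` (?t -` E) \<inter> P \<in> sets M"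
      by (intro gens_sets gens_box act_vimage t)
    also have "\<Phi> -` (act (\<lambda>i. if i \<in> L then m i else 0) -` D) \<inter> tot -` (?t -` E) \<inter> P =
        sh L m -` A \<inter> space M"
      unfolding A space_M
      by (intro set_eqI) (simp only: vimage_eq Int_iff Phi_sh tot_sh sh_mem simp_thms)
    finally show ?thesis .
  next
    fix k z E assume A: "A = ins k z ` E" and k: "k \<in> L" "z \<in> Z k" "E \<in> sets \<Lambda>"
    have "ins k (sh (L - {k}) (\<lambda>i. - m i) z) ` (?t -` E) \<in> sets M"
      using k(1) t[OF k(3)] by (intro gens_sets gens_line sh_mem)
    also have "ins k (sh (L - {k}) (\<lambda>i. - m i) z) ` (?t -` E) = sh L m -` A \<inter> space M"
    proof (rule set_eqI)
      fix x
      have "drop_coord l k x = sh (L - {k}) (\<lambda>i. - m i) z \<longleftrightarrow> sh (L - {k}) m (drop_coord l k x) = z"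
        if "x \<in> P" using sh_inverse[of _ "L - {k}" m] drop_mem[OF that, of k] k(2) by metis
      then show "x \<in> ins k (sh (L - {k}) (\<lambda>i. - m i) z) ` (?t -` E) \<longleftrightarrow> x \<in> sh L m -` A \<inter> space M"
        unfolding A ins_image_eq[OF k(1,2)] ins_image_eq[OF k(1) sh_mem] space_M
        by (simp only: mem_Collect_eq vimage_eq Int_iff drop_sh tot_sh sh_mem) blast
    qed
    finally show ?thesis .
  qed
qed

text \<open>A translation carries lines to lines and shifts the parameter by an integer, which
  preserves \<open>\<Lambda>\<close>. Since a measure can be read off any unexceptional line, one
  suitable pair of lines suffices.\<close>

lemma distr_sh: "distr M M (sh L m) = M"
proof (rule measure_eqI)
  fix A assume "A \<in> sets (distr M M (sh L m))"
  then have A: "A \<in> sets M" by simp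
  let ?B = "sh L m -` A \<inter> space M"
  let ?t = "\<lambda>g :: real \<times> int. g + (0, \<Sum>i\<in>L. m i)"
  have B: "?B \<in> sets M" by (rule measurable_sets[OF sh_measurable A])
  have k: "1 \<in> L" using l_pos by simp
  obtain K where K: "small K" "\<forall>z\<in>Z 1 - K. emeasure \<Lambda> (ins 1 z -` A) = emeasure M A"
    using const_sectionsD(3)[OF const_sections_emeasure[OF A] k] by (elim exE conjE)
  obtain K' where K': "small K'" "\<forall>z\<in>Z 1 - K'. emeasure \<Lambda> (ins 1 z -` ?B) = emeasure M ?B"
    using const_sectionsD(3)[OF const_sections_emeasure[OF B] k] by (elim exE conjE)
  \<comment> \<open>Avoiding the back-translate of \<open>K\<close> keeps the image line
    \<open>?z\<close> outside \<open>K\<close>.\<close>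
  obtain z where z: "z \<in> Z 1" "z \<notin> K' \<union> sh (L - {1}) (\<lambda>i. - m i) ` K"
    using not_small_Z[OF k small_Un[OF K'(1) small_image[OF K(1)]]] by blast
  let ?z = "sh (L - {1}) m z"
  have "?z \<notin> K"
  proof
    assume "?z \<in> K"
    then have "sh (L - {1}) (\<lambda>i. - m i) ?z \<in> sh (L - {1}) (\<lambda>i. - m i) ` K" by (rule imageI)
    then show False using z sh_inverse(2)[OF z(1)] by simp
  qed
  then have "emeasure M A = emeasure \<Lambda> (ins 1 ?z -` A)" using K(2) sh_mem by simp
  also have "\<dots> = emeasure (distr \<Lambda> \<Lambda> ?t) (ins 1 ?z -` A)" by (simp add: Lambda_shift(2))
  also have "\<dots> = emeasure \<Lambda> (?t -` (ins 1 ?z -` A) \<inter> space \<Lambda>)"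
    using const_sectionsD(2)[OF const_sections_emeasure[OF A] k sh_mem]
    by (intro emeasure_distr Lambda_shift)
  also have "?t -` (ins 1 ?z -` A) \<inter> space \<Lambda> = ins 1 z -` ?B"
    using sh_ins[OF k z(1), of m] ins_mem[OF k z(1)] unfolding space_pullback space_M by auto
  also have "emeasure \<Lambda> \<dots> = emeasure M ?B" using K'(2) z by blast
  finally show "emeasure (distr M M (sh L m)) A = emeasure M A"
    by (simp add: emeasure_distr[OF sh_measurable A])
qed simp

end

section \<open>Disintegration and the clean factor\<close>

context generic_cube begin

definition step :: "nat \<Rightarrow> (nat \<Rightarrow> 'x) \<Rightarrow> nat \<Rightarrow> 'x" where
  "step i = sh L (unit_vec i 1)"

abbreviation side :: "nat \<Rightarrow> (nat \<Rightarrow> 'x) measure" where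
  "side k \<equiv> coord_factor (\<lambda>_. X) M l k"

abbreviation side_step :: "nat \<Rightarrow> nat \<Rightarrow> (nat \<Rightarrow> 'x) \<Rightarrow> nat \<Rightarrow> 'x" where
  "side_step k \<equiv> \<lambda>i. coord_map M l k (step i)"

definition fibre :: "nat \<Rightarrow> (nat \<Rightarrow> 'x) \<Rightarrow> (nat \<Rightarrow> 'x) measure" where
  "fibre k z = distr \<Lambda> M (ins k z)"

lemma iso_sh: "measure_iso M M (sh L m)"
  by (rule measure_isoI[of _ _ _ "sh L (\<lambda>i. - m i)"])
    (simp_all only: sh_measurable distr_sh sh_inverse space_M)

lemma system_M: "dynamical_system l M step"
  unfolding dynamical_system_def step_def
  using prob_M iso_sh by (simp add: sh_add add.commute)

lemma step_apply:
  assumes "x \<in> P" "i \<in> L"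
  shows "step i x = x(i := e (d (x i) + (0, 1)))"
proof (rule PiE_ext)
  show "step i x \<in> P" unfolding step_def by (rule sh_mem)
  show "x(i := e (d (x i) + (0, 1))) \<in> P" using assms by (auto simp: PiE_iff extensional_def)
  fix j assume "j \<in> L"
  then show "step i x j = (x(i := e (d (x i) + (0, 1)))) j"
    using PiE_mem[OF assms(1), of j] by (simp add: step_def sh_def unit_vec_def flip: zero_prod_def)
qed

section \<open>The coordinate factors\<close>

lemma drop_vimage_compl: "A \<subseteq> Z k \<Longrightarrow> drop_coord l k -` (Z k - A) \<inter> P = P - drop_coord l k -` A \<inter> P"
  using drop_mem[of _ k] by blast

text \<open>A preimage under \<open>drop_coord\<close> ignores coordinate \<open>k\<close>, so it is
  its own witness in \<open>coord_algebra\<close>, with empty symmetric difference.\<close>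

lemma coord_algebra_iff:
  "drop_coord l k -` A \<inter> space M \<in> coord_algebra M l k \<longleftrightarrow> drop_coord l k -` A \<inter> space M \<in> sets M"
proof
  assume *: "drop_coord l k -` A \<inter> space M \<in> sets M"
  have "indep_of_coord M l k (drop_coord l k -` A \<inter> space M)"
    unfolding indep_of_coord_def by auto
  then show "drop_coord l k -` A \<inter> space M \<in> coord_algebra M l k"
    using * unfolding coord_algebra_def by (auto intro!: bexI[of _ "drop_coord l k -` A \<inter> space M"])
qed (simp add: coord_algebra_def)

lemma space_side: "space (side k) = Z k"
  unfolding coord_factor_def by (simp add: space_measure_of_conv)

lemma sets_side: "sets (side k) = {A. A \<subseteq> Z k \<and> drop_coord l k -` A \<inter> P \<in> sets M}"
proof -
  let ?S = "{A. A \<subseteq> Z k \<and> drop_coord l k -` A \<inter> P \<in> sets M}"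
  have sub: "?S \<subseteq> Pow (Z k)" by blast
  have "sigma_algebra (Z k) ?S"
  proof (rule sigma_algebra_iff2[THEN iffD2], intro conjI ballI allI impI)
    show "{} \<in> ?S" by simp
  next
    fix A assume A: "A \<in> ?S"
    then have "drop_coord l k -` (Z k - A) \<inter> P = space M - drop_coord l k -` A \<inter> P"
      using drop_vimage_compl[of A k] by (simp add: space_M)
    then show "Z k - A \<in> ?S" using A by auto
  next
    fix A :: "nat \<Rightarrow> _" assume A: "range A \<subseteq> ?S"
    have Ai: "A i \<subseteq> Z k" "drop_coord l k -` A i \<inter> P \<in> sets M" for i
      using subsetD[OF A rangeI, of i] by simp_all
    have "drop_coord l k -` (\<Union>i. A i) \<inter> P = (\<Union>i. drop_coord l k -` A i \<inter> P)" by blast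
    moreover have "(\<Union>i. drop_coord l k -` A i \<inter> P) \<in> sets M"
      by (rule sets.countable_UN) (use Ai in blast)
    ultimately show "(\<Union>i. A i) \<in> ?S" using Ai(1) by (simp only: mem_Collect_eq UN_least simp_thms)
  qed (rule sub)
  then have "sigma_sets (Z k) ?S = ?S" by (rule sigma_algebra.sigma_sets_eq)
  then show ?thesis
    unfolding coord_factor_def sets_distr using sub
    by (simp add: coord_algebra_iff[unfolded space_M] space_M sets_measure_of)
qed

lemma drop_measurable: "drop_coord l k \<in> M \<rightarrow>\<^sub>M side k"
proof (rule measurableI)
  show "drop_coord l k x \<in> space (side k)" if "x \<in> space M" for x
    using drop_mem that unfolding space_side space_M by blast
qed (simp add: sets_side space_M)

lemma distr_drop: "distr M (side k) (drop_coord l k) = side k"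
  unfolding coord_factor_def by (rule distr_cong) simp_all

lemma emeasure_side:
  "A \<in> sets (side k) \<Longrightarrow> emeasure (side k) A = emeasure M (drop_coord l k -` A \<inter> P)"
  using emeasure_distr[OF drop_measurable, of A k] unfolding distr_drop space_M by simp

lemma countable_side:
  assumes "k \<in> L" "countable K" "K \<subseteq> Z k"
  shows "K \<in> sets (side k)"
proof -
  have "drop_coord l k -` K \<inter> P = (\<Union>z\<in>K. drop_coord l k -` {z} \<inter> P)" by blast
  also have "\<dots> \<in> sets M" using assms fibre_sets[OF assms(1)] by (intro sets.countable_UN') auto
  finally show ?thesis using assms(3) by (simp add: sets_side)
qed

text \<open>The preimage of a countable set is a countable union of fibres, each null unless
  \<open>l = 1\<close>, where small sets are empty.\<close>

lemma AE_not_small: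
  assumes "k \<in> L" "small K"
  shows "AE z in side k. z \<notin> K"
proof (cases "l = 1")
  case True
  then have "K = {}" using assms(2) unfolding small_def by blast
  then show ?thesis by simp
next
  case False
  have K: "countable (K \<inter> Z k)" using assms by (auto simp: small_def)
  have "drop_coord l k -` (K \<inter> Z k) \<inter> P = (\<Union>z\<in>K \<inter> Z k. drop_coord l k -` {z} \<inter> P)" by blast
  moreover have "\<dots> \<in> null_sets M" using K fibre_null[OF assms(1) _ False] by (intro null_sets_UN') auto
  ultimately have "K \<inter> Z k \<in> null_sets (side k)"
    using countable_side[OF assms(1) K] by (simp add: null_sets_def emeasure_side)
  then show ?thesis by (rule AE_I') (auto simp: space_side)
qed

text \<open>The projection of a translated point depends only on the projection of the point, so the
  choice made by \<open>SOME\<close> does not matter.\<close>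

lemma coord_map_sh:
  assumes "k \<in> L" "z \<in> Z k"
  shows "coord_map M l k (sh L m) z = sh (L - {k}) m z"
proof -
  have "\<exists>x. x \<in> space M \<and> drop_coord l k x = z"
    using ins_mem[OF assms] drop_ins[OF assms] unfolding space_M by blast
  from someI_ex[OF this] show ?thesis unfolding coord_map_def drop_sh by simp
qed

lemma sh_side_measurable: "sh (L - {k}) m \<in> side k \<rightarrow>\<^sub>M side k"
proof (rule measurableI)
  fix A assume A: "A \<in> sets (side k)"
  have "drop_coord l k -` (sh (L - {k}) m -` A \<inter> Z k) \<inter> P = sh L m -` (drop_coord l k -` A \<inter> P) \<inter> space M"
    using drop_mem[of _ k] sh_mem[of L m] unfolding space_M vimage_Int by (auto simp only: drop_sh vimage_eq)
  moreover have "\<dots> \<in> sets M" using A by (intro measurable_sets[OF sh_measurable]) (simp add: sets_side)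
  ultimately show "sh (L - {k}) m -` A \<inter> space (side k) \<in> sets (side k)"
    by (simp add: sets_side space_side)
qed (simp only: space_side sh_mem)

lemma distr_sh_side: "distr (side k) (side k) (sh (L - {k}) m) = side k"
proof -
  have "distr (side k) (side k) (sh (L - {k}) m) =
    distr M (side k) (sh (L - {k}) m \<circ> drop_coord l k)"
    by (subst distr_drop[symmetric]) (rule distr_distr[OF sh_side_measurable drop_measurable])
  also have "sh (L - {k}) m \<circ> drop_coord l k = drop_coord l k \<circ> sh L m"
    by (simp add: fun_eq_iff drop_sh)
  also have "distr M (side k) \<dots> = distr (distr M M (sh L m)) (side k) (drop_coord l k)"
    by (rule distr_distr[OF drop_measurable sh_measurable, symmetric])
  finally show ?thesis by (simp only: distr_sh distr_drop)
qed

lemma measure_iso_cong: "(\<And>x. x \<in> space A \<Longrightarrow> f x = g x) \<Longrightarrow> measure_iso A B f \<longleftrightarrow> measure_iso A B g"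
proof -
  assume *: "\<And>x. x \<in> space A \<Longrightarrow> f x = g x"
  then have "inv_into (space A) f = inv_into (space A) g"
    unfolding inv_into_def by (intro ext arg_cong[of _ _ Eps]) auto
  then show ?thesis
    unfolding measure_iso_def using * by (simp cong: bij_betw_cong measurable_cong distr_cong)
qed

lemma iso_sh_side: "measure_iso (side k) (side k) (sh (L - {k}) m)"
  by (rule measure_isoI[of _ _ _ "sh (L - {k}) (\<lambda>i. - m i)"])
    (simp_all only: sh_side_measurable distr_sh_side sh_inverse space_side)

lemma prob_side: "prob_space (side k)"
  using prob_space.prob_space_distr[OF prob_M drop_measurable] unfolding distr_drop .

lemma system_side:
  assumes "k \<in> L"
  shows "dynamical_system l (side k) (side_step k)"
  unfolding dynamical_system_def step_def
proof (intro conjI ballI prob_side)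
  fix i
  show "measure_iso (side k) (side k) (coord_map M l k (sh L (unit_vec i 1)))"
    using iso_sh_side[of k "unit_vec i 1"] coord_map_sh[OF assms]
    by (subst measure_iso_cong[of _ _ "sh (L - {k}) (unit_vec i 1)"]) (simp_all only: space_side)
  fix j z assume "z \<in> space (side k)"
  then show "coord_map M l k (sh L (unit_vec i 1)) (coord_map M l k (sh L (unit_vec j 1)) z) =
    coord_map M l k (sh L (unit_vec j 1)) (coord_map M l k (sh L (unit_vec i 1)) z)"
    by (simp only: space_side coord_map_sh[OF assms] sh_mem sh_add add.commute)
qed

lemma factor_side:
  assumes "k \<in> L"
  shows "factor_system l M step (side k) (side_step k) (drop_coord l k)"
proof -
  have "drop_coord l k ` space M = space (side k)"
    unfolding space_M space_side
  proof (intro equalityI image_subsetI subsetI)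
    fix z assume "z \<in> Z k"
    then show "z \<in> drop_coord l k ` P"
      using drop_ins[OF assms] ins_mem[OF assms] by (metis imageI)
  qed (rule drop_mem)
  moreover have "AE x in M. drop_coord l k (step i x) = side_step k i (drop_coord l k x)" for i
    by (rule AE_I2) (simp only: space_M step_def coord_map_sh[OF assms] drop_mem drop_sh)
  ultimately show ?thesis
    unfolding factor_system_def
    using system_M system_side[OF assms] drop_measurable distr_drop by blast
qed

lemma group_act_M: "x \<in> P \<Longrightarrow> group_act M step l g x = sh L (\<lambda>i. if i \<in> L then g i else 0) x"
  by (rule group_act_eq[where H = "sh L" and S = P]) (simp_all only: sh_zero sh_add sh_mem step_def space_M)

lemma group_act_side:
  "k \<in> L \<Longrightarrow> z \<in> Z k \<Longrightarrow>
    group_act (side k) (side_step k) l g z = sh (L - {k}) (\<lambda>i. if i \<in> L then g i else 0) z"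
  by (rule group_act_eq[where H = "sh (L - {k})" and S = "Z k"])
    (simp_all only: sh_zero sh_add sh_mem step_def space_side coord_map_sh)

section \<open>The fibre measures as a disintegration\<close>

lemma sets_fibre: "sets (fibre k z) = sets M"
  by (simp add: fibre_def)

lemma distr_fibre_sh:
  assumes "k \<in> L" "z \<in> Z k"
  shows "distr (fibre k z) M (sh L m) = fibre k (sh (L - {k}) m z)"
proof -
  let ?t = "\<lambda>g :: real \<times> int. g + (0, \<Sum>i\<in>L. m i)"
  have "distr (fibre k z) M (sh L m) = distr \<Lambda> M (sh L m \<circ> ins k z)"
    unfolding fibre_def by (rule distr_distr[OF sh_measurable ins_measurable[OF assms]])
  also have "sh L m \<circ> ins k z = ins k (sh (L - {k}) m z) \<circ> ?t"
    by (simp add: fun_eq_iff sh_ins[OF assms])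
  also have "distr \<Lambda> M \<dots> = distr (distr \<Lambda> \<Lambda> ?t) M (ins k (sh (L - {k}) m z))"
    by (rule distr_distr[OF ins_measurable[OF assms(1) sh_mem] Lambda_shift(1), symmetric])
  finally show ?thesis by (simp only: Lambda_shift(2) fibre_def)
qed

lemma emeasure_fibre:
  "k \<in> L \<Longrightarrow> z \<in> Z k \<Longrightarrow> A \<in> sets M \<Longrightarrow> emeasure (fibre k z) A = emeasure \<Lambda> (ins k z -` A)"
  unfolding fibre_def by (simp add: emeasure_distr[OF ins_measurable] space_pullback)

text \<open>For indicators this is the construction of \<open>M\<close>; sums, multiples and
  monotone limits keep the exceptional set small. Integration over the fibres thus gives an almost
  everywhere constant function.\<close>

lemma nn_integral_fibre:
  assumes k: "k \<in> L" and f: "f \<in> borel_measurable M"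
  shows "\<exists>K. small K \<and> (\<forall>z\<in>Z k - K. (\<integral>\<^sup>+x. f x \<partial>fibre k z) = (\<integral>\<^sup>+x. f x \<partial>M))"
  using f
proof (induction rule: borel_measurable_induct)
  case (cong f g)
  then show ?case
    using nn_integral_cong[of M f g] nn_integral_cong[of "fibre k _" f g]
    by (simp add: sets_eq_imp_space_eq[OF sets_fibre])
next
  case (set A)
  obtain K where "small K" "\<forall>z\<in>Z k - K. emeasure \<Lambda> (ins k z -` A) = emeasure M A"
    using const_sectionsD(3)[OF const_sections_emeasure[OF set] k] by (elim exE conjE)
  then show ?case using set by (intro exI[of _ K]) (simp add: sets_fibre emeasure_fibre[OF k])
next
  case (mult u c)
  then obtain K where "small K" "\<forall>z\<in>Z k - K. (\<integral>\<^sup>+x. u x \<partial>fibre k z) = (\<integral>\<^sup>+x. u x \<partial>M)" by blast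
  moreover have "u \<in> borel_measurable (fibre k z)" for z
    using mult(2) by (simp add: measurable_cong_sets[OF sets_fibre refl])
  ultimately show ?case using mult(2) by (intro exI[of _ K]) (simp add: nn_integral_cmult)
next
  case (add u v)
  obtain K where K: "small K" "\<forall>z\<in>Z k - K. (\<integral>\<^sup>+x. u x \<partial>fibre k z) = (\<integral>\<^sup>+x. u x \<partial>M)"
    using add.IH by blast
  obtain K' where K': "small K'" "\<forall>z\<in>Z k - K'. (\<integral>\<^sup>+x. v x \<partial>fibre k z) = (\<integral>\<^sup>+x. v x \<partial>M)"
    using add.IH by blast
  have "u \<in> borel_measurable (fibre k z)" "v \<in> borel_measurable (fibre k z)" for z
    using add.hyps by (simp_all add: measurable_cong_sets[OF sets_fibre refl])
  then show ?case
    using add.hyps K K' by (intro exI[of _ "K \<union> K'"]) (simp add: nn_integral_add small_Un)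
next
  case (seq U)
  then have "\<forall>i. \<exists>K. small K \<and> (\<forall>z\<in>Z k - K. (\<integral>\<^sup>+x. U i x \<partial>fibre k z) = (\<integral>\<^sup>+x. U i x \<partial>M))" by blast
  from choice[OF this] obtain K where
    K: "\<And>i. small (K i)" "\<And>i. \<forall>z\<in>Z k - K i. (\<integral>\<^sup>+x. U i x \<partial>fibre k z) = (\<integral>\<^sup>+x. U i x \<partial>M)"
    by (elim exE) blast
  have "U i \<in> borel_measurable (fibre k z)" for z i
    using seq(1) by (simp add: measurable_cong_sets[OF sets_fibre refl])
  then have "(\<integral>\<^sup>+x. (SUP i. U i) x \<partial>fibre k z) = (\<integral>\<^sup>+x. (SUP i. U i) x \<partial>M)" if "z \<in> Z k - (\<Union>i. K i)" for z
    using seq(1) \<open>incseq U\<close> K(2) that by (simp add: nn_integral_monotone_convergence_SUP image_image)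
  then show ?case by (intro exI[of _ "\<Union>i. K i"] conjI ballI small_UN K(1))
qed

lemma integral_fibre:
  fixes f :: "(nat \<Rightarrow> 'x) \<Rightarrow> real"
  assumes k: "k \<in> L" and f: "integrable M f"
  shows "\<exists>K. small K \<and> (\<forall>z\<in>Z k - K. integrable (fibre k z) f \<and> (\<integral>x. f x \<partial>fibre k z) = (\<integral>x. f x \<partial>M))"
proof -
  have m: "f \<in> borel_measurable M" using f by simp
  then have m': "f \<in> borel_measurable (fibre k z)" for z
    by (simp add: measurable_cong_sets[OF sets_fibre refl])
  obtain K1 where K1: "small K1"
    "\<forall>z\<in>Z k - K1. (\<integral>\<^sup>+x. ennreal (f x) \<partial>fibre k z) = (\<integral>\<^sup>+x. ennreal (f x) \<partial>M)"
    using nn_integral_fibre[OF k measurable_compose[OF m measurable_ennreal]] by (elim exE conjE)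
  obtain K2 where K2: "small K2"
    "\<forall>z\<in>Z k - K2. (\<integral>\<^sup>+x. ennreal (- f x) \<partial>fibre k z) = (\<integral>\<^sup>+x. ennreal (- f x) \<partial>M)"
    using nn_integral_fibre[OF k measurable_compose[OF borel_measurable_uminus[OF m] measurable_ennreal]]
    by (elim exE conjE)
  have "integrable (fibre k z) f \<and> (\<integral>x. f x \<partial>fibre k z) = (\<integral>x. f x \<partial>M)" if z: "z \<in> Z k - (K1 \<union> K2)" for z
  proof
    show int: "integrable (fibre k z) f"
      using f K1(2) K2(2) z m' by (simp add: real_integrable_def)
    show "(\<integral>x. f x \<partial>fibre k z) = (\<integral>x. f x \<partial>M)"
      using K1(2) K2(2) z by (simp add: real_lebesgue_integral_def[OF int] real_lebesgue_integral_def[OF f])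
  qed
  then show ?thesis using small_Un[OF K1(1) K2(1)] by blast
qed

text \<open>Equivariance holds over every \<open>z\<close>, since translations carry the measure on
  a line to that on its image. The integral formula holds because almost every fibre integral equals
  the whole integral.\<close>

lemma disintegration_side:
  assumes k: "k \<in> L"
  shows "measure_disintegration l M step (side k) (side_step k) (drop_coord l k) (fibre k)"
  unfolding measure_disintegration_def space_side
proof (intro conjI ballI allI)
  fix z assume z: "z \<in> Z k"
  show "sets (fibre k z) = sets M" by (rule sets_fibre)
  show F: "drop_coord l k -` {z} \<inter> space M \<in> sets M"
    using fibre_sets[OF k z] by (simp only: space_M)
  have "space M - drop_coord l k -` {z} = space M - (drop_coord l k -` {z} \<inter> space M)" by blast
  also have "\<dots> \<in> sets M" using F by (rule sets.compl_sets)
  finally have "emeasure (fibre k z) (space M - drop_coord l k -` {z}) =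
      emeasure \<Lambda> (ins k z -` (space M - drop_coord l k -` {z}))"
    by (rule emeasure_fibre[OF k z])
  also have "ins k z -` (space M - drop_coord l k -` {z}) = {}" using drop_ins[OF k z] by auto
  finally show "emeasure (fibre k z) (space M - drop_coord l k -` {z}) = 0" by simp
next
  fix g
  have "fibre k (group_act (side k) (side_step k) l g z) = distr (fibre k z) M (group_act M step l g)"
    if z: "z \<in> Z k" for z
  proof -
    have "space (fibre k z) = P" using sets_eq_imp_space_eq[OF sets_fibre] space_M by simp
    then have "distr (fibre k z) M (group_act M step l g) =
      distr (fibre k z) M (sh L (\<lambda>i. if i \<in> L then g i else 0))"
      by (intro distr_cong refl) (simp only: group_act_M)
    then show ?thesis by (simp only: distr_fibre_sh[OF k z] group_act_side[OF k z])
  qed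
  then show "AE z in side k. fibre k (group_act (side k) (side_step k) l g z) =
      distr (fibre k z) M (group_act M step l g)"
    by (intro AE_I2) (simp only: space_side)
next
  fix f :: "(nat \<Rightarrow> 'x) \<Rightarrow> real" assume "f \<in> L2 M"
  then have m: "f \<in> borel_measurable M" and i2: "integrable M (\<lambda>x. (f x)\<^sup>2)"
    by (auto simp: L2_def)
  interpret M: prob_space M by (rule prob_M)
  interpret S: prob_space "side k" by (rule prob_side)
  have "integrable M f" by (rule M.square_integrable_imp_integrable[OF m i2])
  from integral_fibre[OF k this] obtain K where K: "small K"
    "\<forall>z\<in>Z k - K. integrable (fibre k z) f \<and> (\<integral>x. f x \<partial>fibre k z) = (\<integral>x. f x \<partial>M)"
    by (elim exE conjE)
  have AE: "AE z in side k. z \<in> Z k - K"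
    using AE_not_small[OF k K(1)] AE_space[of "side k"] unfolding space_side by eventually_elim blast
  show "AE z in side k. integrable (fibre k z) f"
    using AE by eventually_elim (use K(2) in blast)
  let ?h = "\<lambda>z. \<integral>x. f x \<partial>fibre k z"
  have eq: "AE z in side k. ?h z = (\<integral>x. f x \<partial>M)" using AE by eventually_elim (use K(2) in blast)
  \<comment> \<open>\<open>?h\<close> is constant off a countable subset of \<open>Z k\<close>, and
    single points are measurable in \<open>side k\<close>; so no completion of the \<sigma>-algebra
    is called for.\<close>
  have meas: "?h \<in> borel_measurable (side k)"
  proof (rule measurable_discrete_difference[where X = "K \<inter> Z k" and f = "\<lambda>_. \<integral>x. f x \<partial>M"])
    show "countable (K \<inter> Z k)" using K(1) by (auto simp: small_def)
    show "{z} \<in> sets (side k)" if "z \<in> K \<inter> Z k" for z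
      using countable_side[OF k, of "{z}"] that by simp
    show "(\<integral>x. f x \<partial>M) = ?h z" if "z \<in> space (side k)" "z \<notin> K \<inter> Z k" for z
      using K(2) that by (simp add: space_side)
  qed simp_all
  show "integrable (side k) ?h"
    using integrable_cong_AE[OF meas _ eq] by simp
  show "(\<integral>x. f x \<partial>M) = (\<integral>z. ?h z \<partial>side k)"
    using integral_cong_AE[OF meas _ eq] by (simp add: S.prob_space)
qed

section \<open>The clean factor\<close>

definition \<gamma> :: "(nat \<Rightarrow> 'x) \<Rightarrow> 'x" where "\<gamma> x = e (tot x)"

abbreviation axis :: "'x measure" where "axis \<equiv> embed_measure \<Lambda> e"

text \<open>Each of the \<open>l\<close> transformations raises the coordinate sum by
  \<open>(0, 1)\<close>, so all of them induce this one map on the factor. The same map moves the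
  i-th coordinate under \<open>step i\<close>.\<close>

definition axis_step :: "'x \<Rightarrow> 'x" where "axis_step y = e (d y + (0, 1))"

lemma space_axis: "space axis = X"
  by (simp add: space_embed_measure space_pullback)

lemma e_measurable: "e \<in> \<Lambda> \<rightarrow>\<^sub>M axis"
  using inj_e by (intro measurable_embed_measure2) (simp add: space_pullback)

lemma d_measurable: "d \<in> axis \<rightarrow>\<^sub>M \<Lambda>"
proof (rule measurableI)
  fix E assume "E \<in> sets \<Lambda>"
  then have "e ` E \<in> sets axis" by (rule in_sets_embed_measure)
  also have "e ` E = d -` E \<inter> space axis" by (auto simp: space_axis)
  finally show "d -` E \<inter> space axis \<in> sets axis" .
qed (simp add: space_pullback)

lemma distr_e: "distr \<Lambda> axis e = axis"
  using embed_measure_eq_distr[of e \<Lambda>] inj_e by simp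

lemma distr_d: "distr axis \<Lambda> d = \<Lambda>"
  using distr_distr[OF d_measurable e_measurable] unfolding distr_e by (simp add: comp_def distr_id2)

lemma axis_step_measurable: "(\<lambda>y. e (d y + (0, n))) \<in> axis \<rightarrow>\<^sub>M axis"
  by (intro measurable_compose[OF d_measurable] measurable_compose[OF Lambda_shift(1) e_measurable])

lemma distr_axis_step: "distr axis axis (\<lambda>y. e (d y + (0, n))) = axis"
proof -
  have "distr axis axis (\<lambda>y. e (d y + (0, n))) = distr (distr axis \<Lambda> d) axis (e \<circ> (\<lambda>g. g + (0, n)))"
    using distr_distr[OF measurable_comp[OF Lambda_shift(1) e_measurable] d_measurable, symmetric]
    by (simp add: comp_def)
  also have "\<dots> = distr (distr \<Lambda> \<Lambda> (\<lambda>g. g + (0, n))) axis e"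
    unfolding distr_d by (rule distr_distr[OF e_measurable Lambda_shift(1), symmetric])
  finally show ?thesis unfolding Lambda_shift(2) distr_e .
qed

lemma prob_axis: "prob_space axis"
  using prob_space.prob_space_distr[OF prob_Lambda e_measurable] unfolding distr_e .

lemma system_axis: "dynamical_system l axis (\<lambda>_. axis_step)"
proof -
  have "measure_iso axis axis (\<lambda>y. e (d y + (0, 1)))"
    by (rule measure_isoI[of _ _ _ "\<lambda>y. e (d y + (0, - 1))"])
      (simp_all add: axis_step_measurable distr_axis_step space_axis add.assoc flip: zero_prod_def)
  then show ?thesis unfolding dynamical_system_def axis_step_def using prob_axis by simp
qed

lemma gamma_measurable: "\<gamma> \<in> M \<rightarrow>\<^sub>M axis"
  unfolding \<gamma>_def by (rule measurable_compose[OF tot_measurable e_measurable])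

lemma distr_gamma: "distr M axis \<gamma> = axis"
  using distr_distr[OF e_measurable tot_measurable] unfolding distr_tot distr_e
  by (simp add: comp_def \<gamma>_def[abs_def])

lemma gamma_step:
  assumes "i \<in> L"
  shows "\<gamma> (sh L (unit_vec i n) x) = e (tot x + (0, n))"
  unfolding \<gamma>_def tot_sh using assms by (simp add: unit_vec_def)

lemma factor_axis: "factor_system l M step axis (\<lambda>_. axis_step) \<gamma>"
proof -
  have "\<gamma> ` space M = space axis"
  proof
    show "\<gamma> ` space M \<subseteq> space axis" by (auto simp: \<gamma>_def space_axis)
    have k: "1 \<in> L" using l_pos by simp
    obtain z where z: "z \<in> Z 1" using not_small_Z[OF k small_empty] by blast
    show "space axis \<subseteq> \<gamma> ` space M"
    proof
      fix y assume "y \<in> space axis"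
      then obtain g where "y = e g" by (auto simp: space_axis)
      then have "y = \<gamma> (ins 1 z g)" by (simp only: \<gamma>_def tot_ins[OF k])
      then show "y \<in> \<gamma> ` space M" using ins_mem[OF k z] by (simp only: space_M image_eqI)
    qed
  qed
  moreover have "AE x in M. \<gamma> (step i x) = axis_step (\<gamma> x)" if "i \<in> L" for i
    by (rule AE_I2) (simp only: step_def gamma_step[OF that], simp add: axis_step_def \<gamma>_def)
  ultimately show ?thesis
    unfolding factor_system_def using system_M system_axis gamma_measurable distr_gamma by blast
qed

text \<open>In the coordinate \<open>t\<close> the map is translation of the group by the constant
  \<open>rest k z\<close>, which gives the inverse. In the sum parameter it is just
  \<open>e\<close>, and there the fibre measure is \<open>\<Lambda>\<close>, so the image is
  \<open>axis\<close>.\<close>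

lemma fibre_iso:
  assumes k: "k \<in> L" and z: "z \<in> Z k"
  shows "measure_iso (fibre_measure (\<lambda>_. X) M l k z (fibre k z)) axis (\<lambda>t. \<gamma> (z(k := t)))"
proof -
  let ?F = "drop_coord l k -` {z} \<inter> space M"
  let ?V = "vimage_algebra X (\<lambda>t. z(k := t)) M"
  let ?R = "restrict_space (fibre k z) ?F"
  let ?\<mu> = "fibre_measure (\<lambda>_. X) M l k z (fibre k z)"
  have upd: "z(k := t) \<in> P" if "t \<in> X" for t
    using ins_mem[OF k z, of "d t + rest k z"] that by (simp add: ins_def)
  have gam: "\<gamma> (z(k := t)) = e (d t + rest k z)" if "t \<in> X" for t
    using tot_ins[OF k, of z "d t + rest k z"] that by (simp add: ins_def \<gamma>_def)
  have F: "?F \<in> sets M" using fibre_sets[OF k z] by (simp only: space_M)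
  have upd_fib: "z(k := x k) = x" if "x \<in> ?F" for x
  proof -
    have "drop_coord l k x = z" "x \<in> P" using that unfolding space_M by blast+
    then have "ins k z (tot x) = x" using ins_drop[OF k, of x] by simp
    moreover have "z(k := ins k z g k) = ins k z g" for g by (simp add: ins_def)
    ultimately show ?thesis by metis
  qed
  have sp: "space ?R = ?F"
    using sets_eq_imp_space_eq[OF sets_fibre, of k z] by (auto simp: space_restrict_space)
  have idm: "(\<lambda>x. x) \<in> ?R \<rightarrow>\<^sub>M M"
    by (rule measurable_restrict_space1) (simp add: measurable_cong_sets[OF sets_fibre refl])
  \<comment> \<open>On the fibre, reinserting the k-th coordinate into \<open>z\<close> returns the
    point itself, so measurability into the algebra of sections reduces to that of the
    identity.\<close>
  have m1: "(\<lambda>x. x k) \<in> ?R \<rightarrow>\<^sub>M ?V"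
  proof (rule measurable_vimage_algebra2)
    show "(\<lambda>x. x k) \<in> space ?R \<rightarrow> X" using k unfolding sp by (auto simp: space_M dest: PiE_mem)
    show "(\<lambda>x. z(k := x k)) \<in> ?R \<rightarrow>\<^sub>M M"
      using idm upd_fib by (subst measurable_cong[of _ _ "\<lambda>x. x"]) (auto simp only: sp)
  qed
  have V: "sets ?\<mu> = sets ?V" "space ?\<mu> = X" by (simp_all add: fibre_measure_def)
  have m2: "(\<lambda>t. \<gamma> (z(k := t))) \<in> ?V \<rightarrow>\<^sub>M axis"
    by (rule measurable_compose[OF measurable_vimage_algebra1 gamma_measurable]) (simp add: upd space_M)
  have m3: "(\<lambda>y. e (d y - rest k z)) \<in> axis \<rightarrow>\<^sub>M ?V"
  proof (rule measurable_vimage_algebra2)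
    show "(\<lambda>y. z(k := e (d y - rest k z))) \<in> axis \<rightarrow>\<^sub>M M"
      using measurable_compose[OF d_measurable ins_measurable[OF k z]] unfolding ins_def .
  qed auto
  show ?thesis
  proof (rule measure_isoI[of _ _ _ "\<lambda>y. e (d y - rest k z)"])
    show "(\<lambda>t. \<gamma> (z(k := t))) \<in> ?\<mu> \<rightarrow>\<^sub>M axis" using m2 by (simp only: measurable_cong_sets[OF V(1) refl])
    show "(\<lambda>y. e (d y - rest k z)) \<in> axis \<rightarrow>\<^sub>M ?\<mu>" using m3 by (simp only: measurable_cong_sets[OF refl V(1)])
    show "e (d (\<gamma> (z(k := t))) - rest k z) = t" if "t \<in> space ?\<mu>" for t
      using that by (simp add: V(2) gam)
    show "\<gamma> (z(k := e (d y - rest k z))) = y" if "y \<in> space axis" for y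
      using that by (simp add: space_axis gam)
    have "distr ?\<mu> axis (\<lambda>t. \<gamma> (z(k := t))) = distr ?R axis (\<lambda>x. \<gamma> (z(k := x k)))"
      unfolding fibre_measure_def using distr_distr[OF m2 m1] by (simp add: comp_def)
    also have "\<dots> = distr ?R axis \<gamma>" using upd_fib by (intro distr_cong) (simp_all only: sp)
    also have "\<dots> = axis"
    proof (rule measure_eqI)
      have m4: "\<gamma> \<in> ?R \<rightarrow>\<^sub>M axis" using measurable_compose[OF idm gamma_measurable] .
      fix A assume "A \<in> sets (distr ?R axis \<gamma>)"
      then have A: "A \<in> sets axis" by simp
      have B: "\<gamma> -` A \<inter> ?F \<in> sets M"
      proof -
        have "\<gamma> -` A \<inter> ?F = (\<gamma> -` A \<inter> space M) \<inter> ?F" by blast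
        then show ?thesis using measurable_sets[OF gamma_measurable A] F by (simp only: sets.Int)
      qed
      have "emeasure (distr ?R axis \<gamma>) A = emeasure ?R (\<gamma> -` A \<inter> ?F)"
        using A by (simp add: emeasure_distr[OF m4] sp)
      also have "\<dots> = emeasure (fibre k z) (\<gamma> -` A \<inter> ?F)"
        using F sets_eq_imp_space_eq[OF sets_fibre, of k z]
        by (intro emeasure_restrict_space) (auto simp: sets_fibre Int_absorb2 sets.sets_into_space)
      also have "\<dots> = emeasure \<Lambda> (ins k z -` (\<gamma> -` A \<inter> ?F))" by (rule emeasure_fibre[OF k z B])
      also have "ins k z -` (\<gamma> -` A \<inter> ?F) = e -` A \<inter> space \<Lambda>"
        using drop_ins[OF k z] ins_mem[OF k z] tot_ins[OF k] by (auto simp: \<gamma>_def space_M space_pullback)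
      also have "emeasure \<Lambda> \<dots> = emeasure (distr \<Lambda> axis e) A"
        by (rule emeasure_distr[OF e_measurable A, symmetric])
      finally show "emeasure (distr ?R axis \<gamma>) A = emeasure axis A" unfolding distr_e .
    qed simp
    finally show "distr ?\<mu> axis (\<lambda>t. \<gamma> (z(k := t))) = axis" .
  qed
qed

text \<open>The coordinate sum loses \<open>(0, 1)\<close> under the inverse of
  \<open>step j\<close> and regains it under \<open>step i\<close>.\<close>

lemma cleanly_factors_axis: "cleanly_factors l (\<lambda>_. X) M step fibre axis (\<lambda>_. axis_step) \<gamma>"
  unfolding cleanly_factors_def
proof (intro conjI ballI factor_axis)
  fix i j assume i: "i \<in> L" and j: "j \<in> L"
  show "AE x in M. \<gamma> x = \<gamma> (step i (inv_into (space M) (step j) x))"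
  proof (rule AE_I2)
    fix x assume x: "x \<in> space M"
    have "inv_into (space M) (step j) x = sh L (unit_vec j (- 1)) x"
    proof (rule inv_into_f_eq)
      have "step j (sh L (unit_vec j (- 1)) y) = y" "sh L (unit_vec j (- 1)) (step j y) = y"
        if "y \<in> space M" for y
        using that sh_inverse[of y L "unit_vec j 1"] unfolding space_M step_def
        by (simp_all add: unit_vec_def[abs_def] if_distrib[of uminus] cong: if_cong)
      then show "inj_on (step j) (space M)" "step j (sh L (unit_vec j (- 1)) x) = x"
        using x by (auto intro: inj_on_inverseI)
    qed (simp only: space_M sh_mem)
    then have "tot (inv_into (space M) (step j) x) = tot x + (0, - 1)"
      using j by (simp add: tot_sh unit_vec_def)
    then show "\<gamma> x = \<gamma> (step i (inv_into (space M) (step j) x))"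
      unfolding step_def gamma_step[OF i] unfolding step_def[symmetric]
      by (simp add: \<gamma>_def add.assoc flip: zero_prod_def)
  qed
next
  fix k assume "k \<in> L"
  then show "AE z in side k. measure_iso (fibre_measure (\<lambda>_. X) M l k z (fibre k z)) axis (\<lambda>t. \<gamma> (z(k := t)))"
    by (intro AE_I2 fibre_iso) (simp_all only: space_side)
qed

end

section \<open>The action of the integer lattice and convergence\<close>

locale invertible_on =
  fixes S :: "'s set" and R :: "'s \<Rightarrow> 's"
  assumes bij: "bij_betw R S S"
begin

abbreviation "R' \<equiv> inv_into S R"

lemma R_mem: "x \<in> S \<Longrightarrow> R x \<in> S"
  using bij bij_betwE by blast

lemma R'_mem: "x \<in> S \<Longrightarrow> R' x \<in> S"
  using bij_betwE[OF bij_betw_inv_into[OF bij]] by blast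

lemma R_R': "x \<in> S \<Longrightarrow> R (R' x) = x"
  by (rule bij_betw_inv_into_right[OF bij])

lemma R'_R: "x \<in> S \<Longrightarrow> R' (R x) = x"
  by (rule bij_betw_inv_into_left[OF bij])

end

lemma int_iterate_mem:
  assumes "bij_betw R (space M) (space M)" "x \<in> space M"
  shows "int_iterate M R n x \<in> space M"
proof -
  interpret invertible_on "space M" R by standard (fact assms(1))
  have "(R ^^ k) x \<in> space M" "(R' ^^ k) x \<in> space M" for k
    by (induction k) (simp_all add: assms(2) R_mem R'_mem)
  then show ?thesis by (simp add: int_iterate_def)
qed

lemma int_iterate_step:
  assumes "bij_betw R (space M) (space M)" "x \<in> space M"
  shows "int_iterate M R (n + 1) x = R (int_iterate M R n x)"
proof (cases "0 \<le> n")
  case True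
  then have "nat (n + 1) = Suc (nat n)" by simp
  then show ?thesis using True by (simp add: int_iterate_def)
next
  case False
  interpret invertible_on "space M" R by standard (fact assms(1))
  have mem: "(R' ^^ k) x \<in> space M" for k
    by (induction k) (simp_all add: assms(2) R'_mem)
  obtain k where n: "n = - int (Suc k)" using False by (cases n) auto
  have "nat (- n) = Suc k" "nat (- (n + 1)) = k" "n + 1 = 0 \<longleftrightarrow> k = 0" "0 \<le> n + 1 \<longleftrightarrow> k = 0"
    using n by simp_all
  then have "int_iterate M R (n + 1) x = (R' ^^ k) x" "int_iterate M R n x = R' ((R' ^^ k) x)"
    using False by (simp_all add: int_iterate_def)
  then show ?thesis by (simp add: R_R' mem)
qed

text \<open>Induction in both directions from 0; in the downward step the two sides agree after one
  more application of \<open>R\<close>, which is injective on the space.\<close>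

lemma int_iterate_add:
  assumes "bij_betw R (space M) (space M)" "x \<in> space M"
  shows "int_iterate M R m (int_iterate M R n x) = int_iterate M R (m + n) x"
proof (induction m rule: int_induct[of _ 0])
  case base
  show ?case by (simp add: int_iterate_def)
next
  case (step1 i)
  then show ?case
    using int_iterate_step[OF assms, of "i + n"] int_iterate_step[OF assms(1) int_iterate_mem[OF assms], of i]
    by (simp add: ac_simps)
next
  case (step2 i)
  interpret invertible_on "space M" R by standard (fact assms(1))
  have "R (int_iterate M R (i - 1) (int_iterate M R n x)) = R (int_iterate M R (i - 1 + n) x)"
    using step2 int_iterate_step[OF assms, of "i - 1 + n"]
      int_iterate_step[OF assms(1) int_iterate_mem[OF assms], of "i - 1"]
    by (simp add: algebra_simps)
  then show ?case
    using bij_betw_imp_inj_on[OF assms(1)] int_iterate_mem[OF assms(1)] assms(2) by (auto dest: inj_onD)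
qed

lemma int_iterate_commute:
  assumes R: "bij_betw R (space M) (space M)" and F: "\<And>x. x \<in> space M \<Longrightarrow> F x \<in> space M"
    and c: "\<And>x. x \<in> space M \<Longrightarrow> F (R x) = R (F x)" and x: "x \<in> space M"
  shows "F (int_iterate M R n x) = int_iterate M R n (F x)"
proof -
  interpret invertible_on "space M" R by standard (fact R)
  have c': "F (R' y) = R' (F y)" if "y \<in> space M" for y
    using c[OF R'_mem[OF that]] R_R'[OF that] R'_R[OF F[OF R'_mem[OF that]]] by simp
  have mem: "(R ^^ k) x \<in> space M" "(R' ^^ k) x \<in> space M" for k
    by (induction k) (simp_all add: x R_mem R'_mem)
  have "F ((R ^^ k) x) = (R ^^ k) (F x)" "F ((R' ^^ k) x) = (R' ^^ k) (F x)" for k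
    by (induction k) (simp_all add: c c' mem)
  then show ?thesis by (simp add: int_iterate_def)
qed

lemma measure_iso_inv:
  assumes "measure_iso M M R"
  shows "distr M M (inv_into (space M) R) = M"
proof -
  have R: "R \<in> M \<rightarrow>\<^sub>M M" "inv_into (space M) R \<in> M \<rightarrow>\<^sub>M M" "distr M M R = M" "bij_betw R (space M) (space M)"
    using assms unfolding measure_iso_def by simp_all
  have "distr M M (inv_into (space M) R) = distr (distr M M R) M (inv_into (space M) R)" by (simp only: R(3))
  also have "\<dots> = distr M M (inv_into (space M) R \<circ> R)" by (rule distr_distr[OF R(2,1)])
  also have "\<dots> = distr M M (\<lambda>x. x)"
    by (rule distr_cong) (simp_all add: bij_betw_inv_into_left[OF R(4)])
  finally show ?thesis by (simp add: distr_id)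
qed

lemma int_iterate_preserving:
  assumes "measure_iso M M R"
  shows "int_iterate M R n \<in> M \<rightarrow>\<^sub>M M" "distr M M (int_iterate M R n) = M"
proof -
  have pow: "Q ^^ k \<in> M \<rightarrow>\<^sub>M M \<and> distr M M (Q ^^ k) = M"
    if Q: "Q \<in> M \<rightarrow>\<^sub>M M" "distr M M Q = M" for Q and k :: nat
  proof (induction k)
    case 0
    show ?case by (simp add: id_def distr_id)
  next
    case (Suc k)
    then show ?case using Q distr_distr[of Q M M "Q ^^ k" M] measurable_comp[of "Q ^^ k" M M Q M] by (simp add: comp_def)
  qed
  have R: "R \<in> M \<rightarrow>\<^sub>M M" "inv_into (space M) R \<in> M \<rightarrow>\<^sub>M M" "distr M M R = M"
    using assms unfolding measure_iso_def by simp_all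
  show "int_iterate M R n \<in> M \<rightarrow>\<^sub>M M" "distr M M (int_iterate M R n) = M"
    using pow[OF R(1,3)] pow[OF R(2) measure_iso_inv[OF assms]] by (simp_all add: int_iterate_def)
qed

section \<open>The lattice action of a commuting system\<close>

context
  fixes l :: nat and Y :: "'y measure" and T :: "nat \<Rightarrow> 'y \<Rightarrow> 'y"
  assumes sys: "dynamical_system l Y T"
begin

lemma sys_iso: "i \<in> {1..l} \<Longrightarrow> measure_iso Y Y (T i)"
  using sys unfolding dynamical_system_def by blast

lemma sys_bij: "i \<in> {1..l} \<Longrightarrow> bij_betw (T i) (space Y) (space Y)"
  using sys_iso unfolding measure_iso_def by blast

lemma sys_commute: "i \<in> {1..l} \<Longrightarrow> j \<in> {1..l} \<Longrightarrow> y \<in> space Y \<Longrightarrow> T i (T j y) = T j (T i y)"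
  using sys unfolding dynamical_system_def by blast

lemma group_act_mem: "k \<le> l \<Longrightarrow> y \<in> space Y \<Longrightarrow> group_act Y T k m y \<in> space Y"
  by (induction k) (simp_all add: int_iterate_mem[OF sys_bij])

lemma group_act_preserving:
  "k \<le> l \<Longrightarrow> group_act Y T k m \<in> Y \<rightarrow>\<^sub>M Y \<and> distr Y Y (group_act Y T k m) = Y"
proof (induction k)
  case 0
  show ?case by (simp add: distr_id)
next
  case (Suc k)
  have "measure_iso Y Y (T (Suc k))" using Suc.prems by (intro sys_iso) simp
  note it = int_iterate_preserving[OF this, of "m (Suc k)"]
  have "group_act Y T k m \<in> Y \<rightarrow>\<^sub>M Y" "distr Y Y (group_act Y T k m) = Y" using Suc by simp_all
  then show ?case
    using it distr_distr[OF it(1), of "group_act Y T k m" Y] measurable_comp[OF _ it(1), of "group_act Y T k m" Y]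
    by (simp add: comp_def)
qed

lemma group_act_step_commute:
  assumes "k \<le> l" "j \<in> {1..l}" "y \<in> space Y"
  shows "group_act Y T k m (T j y) = T j (group_act Y T k m y)"
  using assms(1)
proof (induction k)
  case (Suc k)
  then have k: "Suc k \<in> {1..l}" by simp
  have "T j (int_iterate Y (T (Suc k)) n x) = int_iterate Y (T (Suc k)) n (T j x)" if "x \<in> space Y" for n x
    using bij_betwE[OF sys_bij[OF assms(2)]] sys_commute[OF assms(2) k] that
    by (intro int_iterate_commute[OF sys_bij[OF k]]) auto
  then show ?case using Suc assms(3) by (simp add: group_act_mem)
qed simp

text \<open>The last iterate of the inner action is moved past the earlier transformations, with
  which it commutes; then the exponents add one coordinate at a time.\<close>

lemma group_act_add:
  assumes "k \<le> l" "y \<in> space Y"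
  shows "group_act Y T k m (group_act Y T k m' y) = group_act Y T k (\<lambda>i. m i + m' i) y"
  using assms(1)
proof (induction k)
  case (Suc k)
  then have k: "Suc k \<in> {1..l}" "k \<le> l" by simp_all
  let ?i = "int_iterate Y (T (Suc k))"
  have mem: "group_act Y T k m' y \<in> space Y" by (rule group_act_mem[OF k(2) assms(2)])
  have "group_act Y T k m (?i (m' (Suc k)) (group_act Y T k m' y)) =
      ?i (m' (Suc k)) (group_act Y T k m (group_act Y T k m' y))"
    using group_act_mem[OF k(2)] group_act_step_commute[OF k(2,1)] mem
    by (intro int_iterate_commute[OF sys_bij[OF k(1)]]) auto
  then show ?case
    using Suc.IH[OF k(2)] int_iterate_add[OF sys_bij[OF k(1)] group_act_mem[OF k(2) assms(2)]]
    by simp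
qed simp

lemma group_act_zero: "group_act Y T k (\<lambda>_. 0) y = y"
  by (induction k) (simp_all add: int_iterate_def)

lemma group_act_unit: "i \<in> {1..k} \<Longrightarrow> group_act Y T k (unit_vec i (int n)) y = (T i ^^ n) y"
proof (induction k)
  case (Suc k)
  have out: "k' < i \<Longrightarrow> group_act Y T k' (unit_vec i (int n)) y = y" for k'
    by (induction k') (auto simp: unit_vec_def int_iterate_def)
  show ?case
  proof (cases "i = Suc k")
    case True
    then have "unit_vec i (int n) (Suc k) = int n" by (simp add: unit_vec_def)
    then show ?thesis using out[of k] True by (simp add: int_iterate_def)
  next
    case False
    then have "i \<in> {1..k}" using Suc.prems by auto
    moreover have "unit_vec i (int n) (Suc k) = 0" using False by (simp add: unit_vec_def)
    ultimately show ?thesis using Suc.IH by (simp add: int_iterate_def)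
  qed
qed simp

end

lemma group_act_cong:
  "(\<And>i. i \<in> {1..k} \<Longrightarrow> m i = m' i) \<Longrightarrow> group_act Y T k m y = group_act Y T k m' y"
  by (induction k) simp_all

text \<open>Both sequences are the same functions \<open>F n\<close> of a point with law \<nu>, so
  only the limit has to be moved. Almost everywhere convergence of a subsequence shows that the
  limit on \<open>M\<close> factors through \<open>p\<close>.\<close>

lemma L2_convergent_transfer:
  fixes F :: "nat \<Rightarrow> 'a \<Rightarrow> 'b::{real_normed_field, euclidean_space}"
  assumes p: "p \<in> M \<rightarrow>\<^sub>M \<nu>" "distr M \<nu> p = \<nu>" and q: "q \<in> Y \<rightarrow>\<^sub>M \<nu>" "distr Y \<nu> q = \<nu>"
    and F[measurable]: "\<And>n. F n \<in> borel_measurable \<nu>"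
    and A: "\<And>n x. x \<in> space M \<Longrightarrow> A n x = F n (p x)"
    and B: "\<And>n y. y \<in> space Y \<Longrightarrow> B n y = F n (q y)"
    and conv: "L2_convergent M A"
  shows "L2_convergent Y B"
proof -
  note p(1)[measurable] q(1)[measurable]
  obtain g where g: "g \<in> L2 M" and
    lim: "(\<lambda>n. \<integral>\<^sup>+x. ennreal ((norm (A n x - g x))\<^sup>2) \<partial>M) \<longlonglongrightarrow> 0"
    using conv unfolding L2_convergent_def by blast
  have gm[measurable]: "g \<in> borel_measurable M" and gi: "integrable M (\<lambda>x. (norm (g x))\<^sup>2)"
    using g by (auto simp: L2_def)
  let ?I = "\<lambda>n. \<integral>\<^sup>+x. ennreal ((norm (F n (p x) - g x))\<^sup>2) \<partial>M"
  have I: "(\<integral>\<^sup>+x. ennreal ((norm (A n x - g x))\<^sup>2) \<partial>M) = ?I n" for n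
    by (rule nn_integral_cong) (simp add: A)
  have lim': "?I \<longlonglongrightarrow> 0" using lim unfolding I .
  then have "eventually (\<lambda>n. ?I n < 1) sequentially" by (rule order_tendstoD) simp
  then obtain n0 where n0: "\<And>n. ?I (n + n0) < 1"
    unfolding eventually_sequentially by (metis le_add2)
  let ?u = "\<lambda>n x. (norm (F (n + n0) (p x) - g x))\<^sup>2"
  have ui: "integrable M (?u n)" for n
    by (rule integrableI_nonneg) (use less_trans[OF n0[of n]] in auto)
  have "(\<integral>x. norm (?u n x) \<partial>M) = enn2real (?I (n + n0))" for n
    by (simp add: integral_eq_nn_integral)
  moreover have "(\<lambda>n. enn2real (?I (n + n0))) \<longlonglongrightarrow> 0"
  proof (rule tendsto_enn2real)
    show "(\<lambda>n. ?I (n + n0)) \<longlonglongrightarrow> ennreal 0"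
      using LIMSEQ_ignore_initial_segment[OF lim', of n0] by simp
  qed simp
  ultimately have "(\<lambda>n. \<integral>x. norm (?u n x) \<partial>M) \<longlonglongrightarrow> 0" by simp
  from tendsto_L1_AE_subseq[OF ui this] obtain r where "AE x in M. (\<lambda>n. ?u (r n) x) \<longlonglongrightarrow> 0" by blast
  then have ae: "AE x in M. (\<lambda>n. F (r n + n0) (p x)) \<longlonglongrightarrow> g x"
  proof eventually_elim
    case (elim x)
    then have "(\<lambda>n. sqrt (?u (r n) x)) \<longlonglongrightarrow> sqrt 0" by (rule tendsto_real_sqrt)
    then show ?case by (simp add: LIM_zero_iff tendsto_norm_zero_iff)
  qed
  \<comment> \<open>The limit is taken before composing with \<open>p\<close>, so \<open>G\<close>
    composed with \<open>q\<close> is available on \<open>Y\<close>. Where the sequence diverges the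
    value of \<open>lim\<close> is arbitrary.\<close>
  define G where "G \<omega> = lim (\<lambda>n. F (r n + n0) \<omega>)" for \<omega>
  have Gm[measurable]: "G \<in> borel_measurable \<nu>" unfolding G_def[abs_def] by measurable
  have gG: "AE x in M. g x = G (p x)"
    using ae by eventually_elim (simp add: G_def limI)
  have "?I n = (\<integral>\<^sup>+y. ennreal ((norm (B n y - G (q y)))\<^sup>2) \<partial>Y)" for n
  proof -
    have "?I n = (\<integral>\<^sup>+x. ennreal ((norm (F n (p x) - G (p x)))\<^sup>2) \<partial>M)"
      by (rule nn_integral_cong_AE) (use gG in \<open>eventually_elim, simp\<close>)
    also have "\<dots> = (\<integral>\<^sup>+\<omega>. ennreal ((norm (F n \<omega> - G \<omega>))\<^sup>2) \<partial>distr M \<nu> p)"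
      by (rule nn_integral_distr[symmetric]) measurable
    also have "\<dots> = (\<integral>\<^sup>+\<omega>. ennreal ((norm (F n \<omega> - G \<omega>))\<^sup>2) \<partial>distr Y \<nu> q)" unfolding p(2) q(2) ..
    also have "\<dots> = (\<integral>\<^sup>+y. ennreal ((norm (F n (q y) - G (q y)))\<^sup>2) \<partial>Y)"
      by (rule nn_integral_distr) measurable
    also have "\<dots> = (\<integral>\<^sup>+y. ennreal ((norm (B n y - G (q y)))\<^sup>2) \<partial>Y)"
      by (rule nn_integral_cong) (simp add: B)
    finally show ?thesis .
  qed
  moreover have "(\<lambda>y. G (q y)) \<in> L2 Y"
  proof -
    have "integrable M (\<lambda>x. (norm (G (p x)))\<^sup>2)"
      by (rule integrable_cong_AE_imp[OF gi]) (use gG in \<open>measurable, eventually_elim, simp\<close>)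
    then have "integrable (distr M \<nu> p) (\<lambda>\<omega>. (norm (G \<omega>))\<^sup>2)"
      by (subst integrable_distr_eq) measurable
    then have "integrable (distr Y \<nu> q) (\<lambda>\<omega>. (norm (G \<omega>))\<^sup>2)" unfolding p(2) q(2) .
    then have "integrable Y (\<lambda>y. (norm (G (q y)))\<^sup>2)"
      by (subst (asm) integrable_distr_eq) measurable
    then show ?thesis unfolding L2_def by simp
  qed
  ultimately show ?thesis using lim' unfolding L2_convergent_def by auto
qed

section \<open>Orbits as points of a sequence space\<close>

text \<open>Exponent vectors are coded by lists because \<open>int list\<close> is countable while
  \<open>nat \<Rightarrow> int\<close> is not; this keeps the number of sequences within the
  continuum. List positions start at 0, exponents at 1.\<close>

definition exponent :: "int list \<Rightarrow> nat \<Rightarrow> int" where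
  "exponent ns i = ns ! (i - 1)"

definition translate :: "(nat \<Rightarrow> int) \<Rightarrow> int list \<Rightarrow> int list" where
  "translate m ns = map (\<lambda>j. ns ! j + m (Suc j)) [0..<length ns]"

definition translate_seq :: "(nat \<Rightarrow> int) \<Rightarrow> (nat \<times> int list \<Rightarrow> 'b) \<Rightarrow> nat \<times> int list \<Rightarrow> 'b" where
  "translate_seq m \<omega> = (\<lambda>(i, ns). \<omega> (i, translate m ns))"

text \<open>Records every \<open>f i\<close> along the whole lattice orbit of \<open>y\<close>.
  Indices without such a meaning receive 0, so that the sequence space can be a full
  product.\<close>

definition orbit_values ::
  "nat \<Rightarrow> 'y measure \<Rightarrow> (nat \<Rightarrow> 'y \<Rightarrow> 'y) \<Rightarrow> (nat \<Rightarrow> 'y \<Rightarrow> 'b::zero) \<Rightarrow> 'y \<Rightarrow> nat \<times> int list \<Rightarrow> 'b" where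
  "orbit_values l Y T f y = (\<lambda>(i, ns).
     if i \<in> {1..l} \<and> length ns = l then f i (group_act Y T l (exponent ns) y) else 0)"

lemma length_translate [simp]: "length (translate m ns) = length ns"
  by (simp add: translate_def)

lemma translate_zero: "translate (\<lambda>_. 0) ns = ns"
  by (simp add: translate_def map_nth)

lemma translate_translate: "translate m (translate m' ns) = translate (\<lambda>i. m i + m' i) ns"
  by (rule nth_equalityI) (simp_all add: translate_def)

lemma exponent_translate:
  assumes "i \<in> {1..length ns}"
  shows "exponent (translate m ns) i = exponent ns i + m i"
proof -
  have "i - 1 < length ns" "Suc (i - 1) = i" using assms by auto
  then show ?thesis by (simp add: exponent_def translate_def)
qed

locale orbit_coding =
  fixes l :: nat and Y :: "'y measure" and T :: "nat \<Rightarrow> 'y \<Rightarrow> 'y"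
    and f :: "nat \<Rightarrow> 'y \<Rightarrow> 'b::{real_normed_field, euclidean_space}"
  assumes sys: "dynamical_system l Y T" and f: "\<And>i. i \<in> {1..l} \<Longrightarrow> f i \<in> borel_measurable Y"
begin

abbreviation "seqs \<equiv> PiM UNIV (\<lambda>_. borel) :: (nat \<times> int list \<Rightarrow> 'b) measure"

abbreviation "\<pi> \<equiv> orbit_values l Y T f"

definition "\<nu> = distr Y seqs \<pi>"

lemma orbit_values_measurable: "\<pi> \<in> Y \<rightarrow>\<^sub>M seqs"
proof (rule measurable_PiM_single')
  fix p :: "nat \<times> int list"
  obtain i ns where p: "p = (i, ns)" by (cases p)
  show "(\<lambda>y. \<pi> y p) \<in> borel_measurable Y"
  proof (cases "i \<in> {1..l} \<and> length ns = l")
    case True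
    then have "(\<lambda>y. f i (group_act Y T l (exponent ns) y)) \<in> borel_measurable Y"
      using group_act_preserving[OF sys order_refl] by (intro measurable_compose[OF _ f]) auto
    then show ?thesis using True by (simp add: p orbit_values_def)
  next
    case False
    then have "(\<lambda>y. \<pi> y p) = (\<lambda>_. 0)" by (auto simp: p orbit_values_def)
    then show ?thesis by simp
  qed
qed (simp add: space_PiM)

lemma translate_seq_measurable: "translate_seq m \<in> seqs \<rightarrow>\<^sub>M seqs"
proof (rule measurable_PiM_single')
  fix p :: "nat \<times> int list"
  have "(\<lambda>\<omega>. \<omega> (fst p, translate m (snd p))) \<in> borel_measurable seqs"
    by (rule measurable_component_singleton) simp
  then show "(\<lambda>\<omega>. translate_seq m \<omega> p) \<in> borel_measurable seqs"
    by (simp add: translate_seq_def split_beta)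
qed (simp add: space_PiM)

text \<open>Moving the starting point adds \<open>m\<close> to every exponent, which only relabels
  the sequence. Translation keeps the length of a list, so padded entries stay 0.\<close>

lemma orbit_values_group_act:
  assumes "y \<in> space Y"
  shows "\<pi> (group_act Y T l m y) = translate_seq m (\<pi> y)"
proof (rule ext, clarify)
  fix i ns
  have "group_act Y T l (\<lambda>i. exponent ns i + m i) y = group_act Y T l (exponent (translate m ns)) y"
    if "length ns = l"
    by (rule group_act_cong) (simp add: exponent_translate that)
  then show "\<pi> (group_act Y T l m y) (i, ns) = translate_seq m (\<pi> y) (i, ns)"
    by (simp add: orbit_values_def translate_seq_def group_act_add[OF sys order_refl assms])
qed

lemma sets_nu: "sets \<nu> = sets seqs"
  by (simp add: \<nu>_def)

lemma space_nu: "space \<nu> = UNIV"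
  by (simp add: \<nu>_def space_PiM)

lemma measurable_nu: "measurable \<nu> = measurable seqs" "measurable N \<nu> = measurable N seqs"
  by (intro ext measurable_cong_sets sets_nu refl) (rule measurable_cong_sets[OF refl sets_nu])

lemma prob_nu: "prob_space \<nu>"
  using sys orbit_values_measurable unfolding dynamical_system_def \<nu>_def
  by (auto intro: prob_space.prob_space_distr)

lemma distr_translate_seq: "distr \<nu> \<nu> (translate_seq m) = \<nu>"
proof -
  have H: "group_act Y T l m \<in> Y \<rightarrow>\<^sub>M Y" "distr Y Y (group_act Y T l m) = Y"
    using group_act_preserving[OF sys order_refl] by blast+
  have "distr \<nu> \<nu> (translate_seq m) = distr \<nu> seqs (translate_seq m)"
    by (rule distr_cong) (simp_all add: sets_nu)
  also have "\<dots> = distr Y seqs (translate_seq m \<circ> \<pi>)"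
    unfolding \<nu>_def by (rule distr_distr[OF translate_seq_measurable orbit_values_measurable])
  also have "\<dots> = distr Y seqs (\<pi> \<circ> group_act Y T l m)"
    by (rule distr_cong) (simp_all add: orbit_values_group_act)
  also have "\<dots> = distr (distr Y Y (group_act Y T l m)) seqs \<pi>"
    by (rule distr_distr[OF orbit_values_measurable H(1), symmetric])
  finally show ?thesis unfolding H(2) \<nu>_def .
qed

lemma orbit_values_funpow:
  assumes "i \<in> {1..l}" "y \<in> space Y"
  shows "\<pi> ((T i ^^ n) y) = translate_seq (unit_vec i (int n)) (\<pi> y)"
  using orbit_values_group_act[OF assms(2)] group_act_unit[OF sys assms(1)] by metis

lemma orbit_values_origin:
  assumes "i \<in> {1..l}"
  shows "\<pi> y (i, replicate l 0) = f i y"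
proof -
  have "group_act Y T l (exponent (replicate l 0)) y = group_act Y T l (\<lambda>_. 0) y"
    by (rule group_act_cong) (auto simp: exponent_def)
  then show ?thesis using assms by (simp add: orbit_values_def group_act_zero[OF sys])
qed

end

text \<open>The empty product is 1, so the averages equal 1 from \<open>N = 1\<close> on; at
  \<open>N = 0\<close> the division by zero yields 0.\<close>

lemma L2_convergent_empty_average:
  fixes Y :: "'y measure" and T :: "nat \<Rightarrow> 'y \<Rightarrow> 'y"
    and f :: "nat \<Rightarrow> 'y \<Rightarrow> 'b::{real_normed_field, euclidean_space}"
  assumes "prob_space Y"
  shows "L2_convergent Y (ergodic_average 0 T f)"
proof -
  interpret prob_space Y by fact
  have "(\<lambda>_. 1) \<in> L2 Y" by (simp add: L2_def)
  moreover have "eventually (\<lambda>N. (\<integral>\<^sup>+y. ennreal ((norm (ergodic_average 0 T f N y - 1))\<^sup>2) \<partial>Y) = 0) sequentially"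
    using eventually_gt_at_top[of 0] by eventually_elim (simp add: ergodic_average_def)
  then have "(\<lambda>N. \<integral>\<^sup>+y. ennreal ((norm (ergodic_average 0 T f N y - 1))\<^sup>2) \<partial>Y) \<longlonglongrightarrow> 0"
    by (rule tendsto_eventually)
  ultimately show ?thesis unfolding L2_convergent_def by (intro bexI[of _ "\<lambda>_. 1"])
qed

section \<open>The extension system for the given functions\<close>

theorem theorem2p4:
  fixes l :: nat
    and Y :: "'y measure" and T :: "nat \<Rightarrow> 'y \<Rightarrow> 'y"
    and f :: "nat \<Rightarrow> 'y \<Rightarrow> 'b::{real_normed_field, euclidean_space}"
  assumes "ergodic_system l Y T"
    and "\<And>i. i \<in> {1..l} \<Longrightarrow> f i \<in> Linf Y"
  shows "\<exists>(X :: nat \<Rightarrow> point set) (M :: (nat \<Rightarrow> point) measure)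
      (T' :: nat \<Rightarrow> (nat \<Rightarrow> point) \<Rightarrow> nat \<Rightarrow> point) (f' :: nat \<Rightarrow> (nat \<Rightarrow> point) \<Rightarrow> 'b)
      (\<mu> :: nat \<Rightarrow> (nat \<Rightarrow> point) \<Rightarrow> (nat \<Rightarrow> point) measure).
    space M = PiE {1..l} X \<and> dynamical_system l M T' \<and> (\<forall>i\<in>{1..l}. f' i \<in> Linf M) \<and>
    (\<forall>k\<in>{1..l}.
       factor_system l M T' (coord_factor X M l k) (\<lambda>i. coord_map M l k (T' i)) (drop_coord l k) \<and>
       measure_disintegration l M T' (coord_factor X M l k) (\<lambda>i. coord_map M l k (T' i))
         (drop_coord l k) (\<mu> k)) \<and>
    (\<exists>(M' :: point measure) R \<gamma>. cleanly_factors l X M T' \<mu> M' R \<gamma>) \<and>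
    (\<forall>i\<in>{1..l}. \<exists>S\<in>X i \<rightarrow> X i. \<forall>x\<in>space M. T' i x = x(i := S (x i))) \<and>
    (L2_convergent M (ergodic_average l T' f') \<longrightarrow> L2_convergent Y (ergodic_average l T f))"
proof (cases "l = 0")
  case False
  interpret orbit_coding l Y T f
    by standard (use assms in \<open>auto simp: ergodic_system_def Linf_def\<close>)
  \<comment> \<open>The value type has a countable basis, hence at most continuum many points; so
    have the sequences over it, and prescriptions can be coded by reals.\<close>
  obtain c :: "'b \<Rightarrow> nat set" where c: "inj c" using embed_second_countable_nat_set by blast
  obtain dec :: "real \<Rightarrow> nat \<Rightarrow> nat \<times> (nat \<Rightarrow> real) \<times> (nat \<times> int list \<Rightarrow> 'b)" where
    dec: "\<And>s. uncountable {u. dec u = s}"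
    using ex_decoding[OF embed_fun_nat_set[OF c, where 'd = "nat \<times> int list"]] by blast
  obtain e :: "real \<times> int \<Rightarrow> point" where e: "inj e" using ex_embedding_point by blast
  interpret C: generic_cube l \<nu> translate_seq dec e
  proof (rule generic_cube.intro)
    show "0 < l" using False by simp
    show "translate_seq m (translate_seq m' \<omega>) = translate_seq (\<lambda>i. m i + m' i) \<omega>"
      for m m' and \<omega> :: "nat \<times> int list \<Rightarrow> 'b"
      by (simp add: translate_seq_def fun_eq_iff translate_translate add.commute)
    show "translate_seq (\<lambda>_. 0) \<omega> = \<omega>" for \<omega> :: "nat \<times> int list \<Rightarrow> 'b"
      by (simp add: translate_seq_def fun_eq_iff translate_zero)
    show "translate_seq m \<in> \<nu> \<rightarrow>\<^sub>M \<nu>" for m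
      unfolding measurable_nu by (rule translate_seq_measurable)
  qed (rule prob_nu space_nu distr_translate_seq dec e)+
  \<comment> \<open>The entry of an orbit sequence that holds \<open>f i\<close> at the starting
    point: all exponents are 0.\<close>
  define origin where "origin i = (i, replicate l 0 :: int list)" for i :: nat
  define f' where "f' i x = C.\<Phi> x (origin i)" for i x
  have coord: "(\<lambda>\<omega>. \<omega> p) \<in> borel_measurable \<nu>" for p
    unfolding measurable_nu by (rule measurable_component_singleton) simp
  have f_eq: "f i y = \<pi> y (origin i)" if "i \<in> {1..l}" for i y
    unfolding origin_def by (rule orbit_values_origin[OF that, symmetric])
  have pi: "\<pi> \<in> Y \<rightarrow>\<^sub>M \<nu>" unfolding measurable_nu by (rule orbit_values_measurable)
  have distr_pi: "distr Y \<nu> \<pi> = \<nu>"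
    unfolding \<nu>_def by (rule distr_cong) simp_all
  have bdd: "f' i \<in> Linf C.M" if i: "i \<in> {1..l}" for i
  proof -
    \<comment> \<open>The bound concerns one coordinate of the sequence, so it passes from
      \<open>Y\<close> to the cube through the common law \<nu>.\<close>
    obtain B where "AE y in Y. norm (f i y) \<le> B" using assms(2)[OF i] by (auto simp: Linf_def)
    then have "AE y in Y. norm (\<pi> y (origin i)) \<le> B" by (simp only: f_eq[OF i])
    moreover have "{\<omega> \<in> space \<nu>. norm (\<omega> (origin i)) \<le> B} \<in> sets \<nu>"
      using coord[of "origin i"] by measurable
    ultimately have "AE \<omega> in distr Y \<nu> \<pi>. norm (\<omega> (origin i)) \<le> B"
      by (subst AE_distr_iff[OF pi]) simp_all
    then have "AE \<omega> in distr C.M \<nu> C.\<Phi>. norm (\<omega> (origin i)) \<le> B"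
      unfolding distr_pi C.distr_Phi .
    then have "AE x in C.M. norm (f' i x) \<le> B"
      unfolding f'_def by (rule AE_distrD[OF C.Phi_measurable])
    moreover have "f' i \<in> borel_measurable C.M"
      unfolding f'_def[abs_def] by (rule measurable_compose[OF C.Phi_measurable coord])
    ultimately show ?thesis by (auto simp: Linf_def)
  qed
  have conv: "L2_convergent Y (ergodic_average l T f)"
    if "L2_convergent C.M (ergodic_average l C.step f')"
  proof -
    \<comment> \<open>The average as a function of the orbit sequence, the same for \<open>Y\<close>
      and for the cube.\<close>
    define F where "F N \<omega> = (\<Sum>n=1..N. \<Prod>i=1..l. translate_seq (unit_vec i (int n)) \<omega> (origin i)) / of_nat N"
      for N and \<omega> :: "nat \<times> int list \<Rightarrow> 'b"
    have tr: "(\<lambda>\<omega>. translate_seq m \<omega> p) \<in> borel_measurable \<nu>" for m p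
      by (rule measurable_compose[OF C.act_measurable coord])
    have F: "F N \<in> borel_measurable \<nu>" for N
      unfolding F_def[abs_def] using tr by measurable
    have Phi: "C.\<Phi> ((C.step i ^^ n) x) = translate_seq (unit_vec i (int n)) (C.\<Phi> x)"
      if "i \<in> {1..l}" "x \<in> space C.M" for i n x
    proof -
      have "(C.step i ^^ n) x = group_act C.M C.step l (unit_vec i (int n)) x"
        using group_act_unit[OF C.system_M that(1)] by simp
      also have "\<dots> = C.sh {1..l} (unit_vec i (int n)) x"
        using that C.group_act_M[of x "unit_vec i (int n)"]
        by (simp add: C.space_M) (auto simp: unit_vec_def intro!: arg_cong[of _ _ "\<lambda>m. C.sh _ m x"])
      finally have "C.\<Phi> ((C.step i ^^ n) x) = translate_seq (\<lambda>j. if j \<in> {1..l} then unit_vec i (int n) j else 0) (C.\<Phi> x)"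
        by (simp only: C.Phi_sh)
      also have "(\<lambda>j. if j \<in> {1..l} then unit_vec i (int n) j else 0) = unit_vec i (int n)"
        using that(1) by (auto simp: unit_vec_def)
      finally show ?thesis .
    qed
    show ?thesis
    proof (rule L2_convergent_transfer[OF C.Phi_measurable C.distr_Phi pi distr_pi F _ _ that])
      show "ergodic_average l C.step f' N x = F N (C.\<Phi> x)" if "x \<in> space C.M" for N x
        unfolding ergodic_average_def F_def f'_def using that
        by (intro arg_cong2[of _ _ _ _ "(/)"] sum.cong prod.cong refl) (simp only: Phi)
      show "ergodic_average l T f N y = F N (\<pi> y)" if "y \<in> space Y" for N y
        unfolding ergodic_average_def F_def using that
        by (intro arg_cong2[of _ _ _ _ "(/)"] sum.cong prod.cong refl) (simp only: f_eq orbit_values_funpow)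
    qed
  qed
  have "\<exists>S\<in>C.X \<rightarrow> C.X. \<forall>x\<in>space C.M. C.step i x = x(i := S (x i))" if "i \<in> {1..l}" for i
    by (rule bexI[of _ C.axis_step]) (auto simp only: C.space_M C.step_apply[OF _ that] C.axis_step_def)
  note S = this
  show ?thesis
  proof (rule exI[of _ "\<lambda>_. C.X"], rule exI[of _ C.M], rule exI[of _ C.step], rule exI[of _ f'],
      rule exI[of _ C.fibre], intro conjI ballI impI)
    show "\<exists>(M' :: point measure) R \<gamma>. cleanly_factors l (\<lambda>_. C.X) C.M C.step C.fibre M' R \<gamma>"
      using C.cleanly_factors_axis by (intro exI)
  qed (rule C.space_M C.system_M bdd C.factor_side C.disintegration_side S conv; assumption?)+
next
  case True
  have Y: "prob_space Y" using assms(1) by (simp add: ergodic_system_def dynamical_system_def)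
  \<comment> \<open>The product over no indices has the single point
    \<open>\<lambda>_. undefined\<close>. Conditions on indices are void, the clean factor is one
    point, and the averages on \<open>Y\<close> converge outright.\<close>
  let ?M = "count_space {\<lambda>_ :: nat. undefined :: point}"
  let ?M' = "count_space {undefined :: point}"
  let ?\<gamma> = "\<lambda>_ :: nat \<Rightarrow> point. undefined :: point"
  have M: "prob_space ?M" "prob_space ?M'" by (auto intro!: prob_spaceI)
  have "distr ?M ?M' ?\<gamma> = ?M'"
  proof (rule measure_eqI)
    fix A assume "A \<in> sets (distr ?M ?M' ?\<gamma>)"
    then have "A = {} \<or> A = {undefined}" by auto
    then show "emeasure (distr ?M ?M' ?\<gamma>) A = emeasure ?M' A"
      by (elim disjE) (simp_all add: emeasure_distr)
  qed simp
  then have "cleanly_factors 0 (\<lambda>_. {}) ?M (\<lambda>_ x. x) (\<lambda>_ _. ?M) ?M' (\<lambda>_ x. x) ?\<gamma>"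
    using M by (auto simp: cleanly_factors_def factor_system_def dynamical_system_def)
  moreover have "space ?M = PiE {1..0} (\<lambda>_. {})" by simp
  moreover have "dynamical_system 0 ?M (\<lambda>_ x. x)" using M by (simp add: dynamical_system_def)
  ultimately show ?thesis
    unfolding True using L2_convergent_empty_average[OF Y]
    by (intro exI[of _ "\<lambda>_. {}"] exI[of _ ?M] exI[of _ "\<lambda>_ x. x"] exI[of _ "\<lambda>_ _. 0"] exI[of _ "\<lambda>_ _. ?M"]) auto
qed

end
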